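(* (i) For $b\ge 3.062$, $$\min_{z\in\mathbb{H}}\big(\zeta(6,z)-b\zeta(3,z)\big)=\min_{z\in\overline{\mathcal{D}_{\mathcal{G}}}}\big(\zeta(6,z)-b\zeta(3,z)\big)=\min_{z\in\Gamma}\big(\zeta(6,z)-b\zeta(3,z)\big).$$ (ii) For $b\ge 3$, $$\min_{z\in\overline{\mathcal{D}_{\mathcal{G}}}\cap\{\Im z\ge1\}}\big(\zeta(6,z)-b\zeta(3,z)\big)=\min_{z\in\Gamma_a}\big(\zeta(6,z)-b\zeta(3,z)\big).$$
   Context: $\mathbb{H}=\{z=x+iy: y>0\}$. For $s>1$, $\zeta(s,z)=\sum_{(m,n)\in\mathbb{Z}^2\setminus\{0\}}\frac{(\Im z)^s}{|mz+n|^{2s}}$. $\mathcal{D}_{\mathcal{G}}=\{z\in\mathbb{H}: |z|>1,\ 0<\Re z<\frac12\}$. $\Gamma_a=\{z\in\mathbb{H}:\Re z=0,\ \Im z\ge1\}$, $\Gamma_b=\{z\in\mathbb{H}: |z|=1,\ \Im z\in[\frac{\sqrt3}{2},1]\}$, $\Gamma=\Gamma_a\cup\Gamma_b$. *)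

theory Defs
  imports "HOL-Analysis.Analysis"
begin

definition upper_half_plane :: "complex set" where
  "upper_half_plane = {z. Im z > 0}"

definition epstein_zeta :: "real \<Rightarrow> complex \<Rightarrow> real" where
  "epstein_zeta s z =
     (\<Sum>\<^sub>\<infinity>(m,n)\<in>(UNIV - {(0,0)} :: (int \<times> int) set).
        (Im z) powr s / (cmod (of_int m * z + of_int n)) powr (2 * s))"

definition D_G :: "complex set" where
  "D_G = {z. Im z > 0 \<and> cmod z > 1 \<and> 0 < Re z \<and> Re z < 1/2}"

definition Gamma_a :: "complex set" where
  "Gamma_a = {z. Im z > 0 \<and> Re z = 0 \<and> Im z \<ge> 1}"

definition Gamma_b :: "complex set" where
  "Gamma_b = {z. Im z > 0 \<and> cmod z = 1 \<and> sqrt 3 / 2 \<le> Im z \<and> Im z \<le> 1}"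

definition Gamma_path :: "complex set" where
  "Gamma_path = Gamma_a \<union> Gamma_b"

definition is_min_on :: "('a \<Rightarrow> real) \<Rightarrow> 'a set \<Rightarrow> real \<Rightarrow> bool" where
  "is_min_on f S m \<longleftrightarrow> (\<exists>z\<in>S. f z = m) \<and> (\<forall>z\<in>S. m \<le> f z)"

end

theory Submission
  imports Defs
begin

text \<open>
  Write \<open>W\<^sub>b = \<zeta>(6, \<cdot>) - b \<zeta>(3, \<cdot>)\<close> and \<open>z = x + i y\<close>. All the minima are attained on the
  half line \<open>x = 0, y \<ge> 1\<close>.

  Summing over one row of the lattice and expanding in a Fourier series in \<open>x\<close> gives
  \<open>\<zeta>(s, i y) - \<zeta>(s, z) = 2 \<Sum>\<^sub>m m\<^sup>-\<^sup>s D\<^sub>s(m x, m y)\<close> with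
  \<open>D\<^sub>s(x, y) = \<Sum>\<^sub>k a\<^sub>s\<^sub>,\<^sub>k(y) (1 - cos 2\<pi>k x)\<close> and coefficients that are elementary (Bessel
  functions of half-integral order) and of size \<open>e\<^sup>-\<^sup>2\<^sup>\<pi>\<^sup>k\<^sup>y\<close>. For \<open>y \<ge> 1\<close> this yields \<open>D\<^sub>6 \<le> 3 D\<^sub>3\<close>,
  so moving horizontally to \<open>x = 0\<close> does not increase \<open>W\<^sub>b\<close> when \<open>b \<ge> 3\<close>.

  In the rest of the fundamental domain, \<open>\<surd>3/2 \<le> y < 1\<close>, every point is compared with \<open>i\<close>. For
  \<open>b = 3.062\<close> the possible loss of a horizontal move to \<open>i y\<close> is a quadratic in \<open>1 - cos 2\<pi>x\<close> with a
  small maximum, and it is outweighed by \<open>W\<^sub>b(i y) - W\<^sub>b(i)\<close>, which Jensen's inequality applied to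
  the pairs of terms \<open>(m, n), (n, m)\<close> bounds from below. The passage to larger \<open>b\<close> uses
  \<open>\<zeta>(3, z) \<le> \<zeta>(3, i)\<close>.
\<close>

section \<open>Fourier expansion of a lattice row\<close>

lemma Digamma_reflection_complex:
  fixes z :: complex
  assumes "z \<notin> \<int>"
  shows "Digamma (1 - z) - Digamma z = of_real pi * cot (of_real pi * z)"
proof -
  have nonpole: "z \<notin> \<int>\<^sub>\<le>\<^sub>0" "1 - z \<notin> \<int>\<^sub>\<le>\<^sub>0"
    using assms nonpos_Ints_Int[of z] nonpos_Ints_Int[of "1 - z"] Ints_diff[of 1 "1 - z"] by auto
  have sin_nz: "sin (of_real pi * z) \<noteq> 0"
    using assms by (auto simp: sin_eq_0)
  have "((\<lambda>w. Gamma w * Gamma (1 - w)) has_field_derivative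
          Gamma z * Digamma z * Gamma (1 - z) - Gamma z * (Gamma (1 - z) * Digamma (1 - z))) (at z)"
    using nonpole by (auto intro!: derivative_eq_intros simp: algebra_simps)
  moreover have "((\<lambda>w. of_real pi / sin (of_real pi * w)) has_field_derivative
          - (of_real pi * (cos (of_real pi * z) * of_real pi)) / (sin (of_real pi * z))\<^sup>2) (at z)"
    using sin_nz by (auto intro!: derivative_eq_intros simp: power2_eq_square)
  ultimately have "Gamma z * Digamma z * Gamma (1 - z) - Gamma z * (Gamma (1 - z) * Digamma (1 - z))
        = - (of_real pi * (cos (of_real pi * z) * of_real pi)) / (sin (of_real pi * z))\<^sup>2"
    unfolding Gamma_reflection_complex by (rule DERIV_unique)
  hence "(Gamma z * Gamma (1 - z)) * (Digamma (1 - z) - Digamma z)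
        = (of_real pi / sin (of_real pi * z)) * (of_real pi * cot (of_real pi * z))"
    using sin_nz by (simp add: cot_def power2_eq_square algebra_simps)
  thus ?thesis
    using sin_nz by (simp add: Gamma_reflection_complex)
qed

lemma cot_eq_geometric_series:
  fixes z :: complex
  assumes "Im z > 0"
  shows "cot (of_real pi * z) = - \<i> * (2 * (\<Sum>k. exp (2 * of_real pi * \<i> * z) ^ k) - 1)"
proof -
  define q where "q = exp (2 * of_real pi * \<i> * z)"
  define e where "e = exp (\<i> * (of_real pi * z))"
  have q: "q = e ^ 2" and e_nz: "e \<noteq> 0"
    by (simp_all add: q_def e_def exp_double[symmetric] mult_ac)
  have norm_q: "norm q < 1"
    using assms by (simp add: q_def)
  hence q_ne_1: "q \<noteq> 1" by auto
  have sin: "sin (of_real pi * z) = (e - inverse e) / (2 * \<i>)"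
    by (simp add: sin_exp_eq e_def exp_minus)
  have cos: "cos (of_real pi * z) = (e + inverse e) / 2"
    by (simp add: cos_exp_eq e_def exp_minus)
  have "cot (of_real pi * z) = - \<i> * (2 / (1 - q) - 1)"
    unfolding cot_def sin cos using e_nz q_ne_1 by (simp add: q field_simps power2_eq_square)
  thus ?thesis
    using suminf_geometric[OF norm_q] by (simp add: q_def[symmetric] divide_inverse)
qed

lemma quadratic_form_lower_bound:
  fixes a x :: real
  assumes "a > 0"
  obtains C where "C > 0"
    "\<And>m n y :: real. y \<ge> a \<Longrightarrow> m\<^sup>2 + n\<^sup>2 \<le> C * ((m * x + n)\<^sup>2 + (m * y)\<^sup>2)"
proof -
  define C where "C = 2 + (2 * x\<^sup>2 + 1) / a\<^sup>2"
  have "m\<^sup>2 + n\<^sup>2 \<le> C * ((m * x + n)\<^sup>2 + (m * y)\<^sup>2)" if "y \<ge> a" for m n y :: real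
  proof -
    have "m\<^sup>2 + n\<^sup>2 + (2 * m * x + n)\<^sup>2 = 2 * (m * x + n)\<^sup>2 + (2 * x\<^sup>2 + 1) * m\<^sup>2"
      by algebra
    also have "(2 * x\<^sup>2 + 1) * m\<^sup>2 = (2 * x\<^sup>2 + 1) / a\<^sup>2 * (m * a)\<^sup>2"
      using assms by (simp add: power_mult_distrib)
    also have "\<dots> \<le> C * (m * y)\<^sup>2"
      using that assms
      by (intro mult_mono) (auto simp: C_def power_mult_distrib intro!: mult_left_mono power_mono)
    also have "2 * (m * x + n)\<^sup>2 \<le> C * (m * x + n)\<^sup>2"
      by (intro mult_right_mono) (auto simp: C_def)
    finally show ?thesis
      unfolding distrib_left using zero_le_power2[of "2 * m * x + n"] by linarith
  qed
  moreover have "C > 0" by (auto simp: C_def intro!: add_pos_nonneg)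
  ultimately show thesis using that by blast
qed

lemma inverse_shifted_square_le:
  fixes a x :: real
  assumes "a > 0"
  obtains C where "\<And>n y. y \<ge> a \<Longrightarrow> 1 / ((x + real n)\<^sup>2 + y\<^sup>2) \<le> C / (real (Suc n))\<^sup>2"
proof -
  obtain C where C: "C > 0" "\<And>m n y. y \<ge> a \<Longrightarrow> m\<^sup>2 + n\<^sup>2 \<le> C * ((m * x + n)\<^sup>2 + (m * y)\<^sup>2)"
    using quadratic_form_lower_bound[OF assms, of x] by blast
  have "1 / ((x + real n)\<^sup>2 + y\<^sup>2) \<le> (2 * C) / (real (Suc n))\<^sup>2" if "y \<ge> a" for n y
  proof -
    have "(real (Suc n))\<^sup>2 \<le> 2 * (1\<^sup>2 + (real n)\<^sup>2)"
      using zero_le_power2[of "real n - 1"] by (simp add: power2_eq_square algebra_simps)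
    also have "\<dots> \<le> 2 * (C * ((1 * x + real n)\<^sup>2 + (1 * y)\<^sup>2))"
      by (intro mult_left_mono C that) auto
    finally have "(real (Suc n))\<^sup>2 \<le> (2 * C) * ((x + real n)\<^sup>2 + y\<^sup>2)" by simp
    moreover have "y\<^sup>2 > 0" using that assms by auto
    ultimately show ?thesis by (simp add: divide_simps add_nonneg_pos mult.commute)
  qed
  thus thesis using that by blast
qed

lemma summable_inverse_Suc_square_power:
  assumes "s \<ge> 1"
  shows "summable (\<lambda>n. (C / (real (Suc n))\<^sup>2) ^ s)"
proof -
  have "summable (\<lambda>n. inverse (real (Suc n) ^ (2 * s)))"
    using assms by (subst summable_Suc_iff) (intro inverse_power_summable, simp)
  hence "summable (\<lambda>n. C ^ s * inverse (real (Suc n) ^ (2 * s)))"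
    by (rule summable_mult)
  moreover have "C ^ s * inverse (real (Suc n) ^ (2 * s)) = (C / (real (Suc n))\<^sup>2) ^ s" for n
    by (simp only: power_divide power_mult) (simp only: divide_inverse)
  ultimately show ?thesis by (simp only:)
qed

definition half_row_sum :: "nat \<Rightarrow> real \<Rightarrow> real \<Rightarrow> real" where
  "half_row_sum s x y = (\<Sum>n::nat. (1 / ((x + n)\<^sup>2 + y\<^sup>2)) ^ s)"

definition row_sum :: "nat \<Rightarrow> real \<Rightarrow> real \<Rightarrow> real" where
  "row_sum s x y = half_row_sum s x y + half_row_sum s (1 - x) y"

lemma summable_half_row_sum:
  fixes x y :: real
  assumes "y > 0" "s \<ge> 1"
  shows "summable (\<lambda>n::nat. (1 / ((x + n)\<^sup>2 + y\<^sup>2)) ^ s)"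
proof -
  obtain C where C: "\<And>n. 1 / ((x + real n)\<^sup>2 + y\<^sup>2) \<le> C / (real (Suc n))\<^sup>2"
    using inverse_shifted_square_le[OF assms(1), of x] by (metis order.refl)
  show ?thesis
  proof (rule summable_comparison_test'[OF summable_inverse_Suc_square_power[OF assms(2), of C]])
    show "norm ((1 / ((x + real n)\<^sup>2 + y\<^sup>2)) ^ s) \<le> (C / (real (Suc n))\<^sup>2) ^ s" for n
      unfolding norm_power using C[of n] by (intro power_mono) (auto simp: abs_mult)
  qed
qed

lemma has_field_derivative_half_row_sum:
  fixes x y :: real
  assumes "y > 0" "s \<ge> 1"
  shows "(half_row_sum s x has_field_derivative (- 2 * s * y * half_row_sum (Suc s) x y)) (at y)"
proof -
  define S where "S = {y/2<..<2*y}"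
  define f where "f n u = (1 / ((x + real n)\<^sup>2 + u\<^sup>2)) ^ s" for n :: nat and u :: real
  define f' where "f' n u = (- 2 * s * u) * (1 / ((x + real n)\<^sup>2 + u\<^sup>2)) ^ Suc s" for n :: nat and u :: real
  obtain C where C: "\<And>n u. u \<ge> y/2 \<Longrightarrow> 1 / ((x + real n)\<^sup>2 + u\<^sup>2) \<le> C / (real (Suc n))\<^sup>2"
    using inverse_shifted_square_le[of "y/2" x] assms by auto
  have deriv: "(f n has_field_derivative f' n u) (at u within S)" if "u \<in> S" for n :: nat and u :: real
  proof -
    have pos: "(x + n)\<^sup>2 + u\<^sup>2 > 0" using that assms by (auto simp: S_def intro!: add_nonneg_pos)
    obtain k where k: "s = Suc k" using assms by (cases s) auto
    have "((\<lambda>u. 1 / ((x + real n)\<^sup>2 + u\<^sup>2)) has_field_derivative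
            (- 2 * u) * (1 / ((x + real n)\<^sup>2 + u\<^sup>2))\<^sup>2) (at u within S)"
      using pos by (auto intro!: derivative_eq_intros simp: power2_eq_square divide_simps)
    moreover have "s * ((- 2 * u) * w\<^sup>2 * w ^ (s - Suc 0)) = (- 2 * s * u) * w ^ Suc s" for w :: real
      by (simp add: k power2_eq_square algebra_simps)
    ultimately show ?thesis
      unfolding f_def[abs_def] f'_def by (metis DERIV_power)
  qed
  have unif: "uniformly_convergent_on S (\<lambda>n u. \<Sum>i<n. f' i u)"
  proof (rule Weierstrass_m_test')
    fix n u assume u: "u \<in> S"
    have "(2 * s * u) * (1 / ((x + n)\<^sup>2 + u\<^sup>2)) ^ Suc s
        \<le> (2 * s * (2 * y)) * (C / (real (Suc n))\<^sup>2) ^ Suc s"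
      using C[of u n] u assms by (intro mult_mono power_mono) (auto simp: S_def)
    thus "norm (f' n u) \<le> (2 * s * (2 * y)) * (C / (real (Suc n))\<^sup>2) ^ Suc s"
      using u assms unfolding f'_def abs_mult real_norm_def norm_power by (simp add: S_def)
  qed (intro summable_mult summable_inverse_Suc_square_power, simp)
  have "((\<lambda>u. \<Sum>n. f n u) has_field_derivative (\<Sum>n. f' n y)) (at y)"
  proof (rule has_field_derivative_series'(2)[OF _ deriv unif, of y])
    show "y \<in> interior S" using assms by (simp add: S_def)
    show "summable (\<lambda>n. f n y)" unfolding f_def by (rule summable_half_row_sum[OF assms])
  qed (use assms in \<open>auto simp: S_def\<close>)
  moreover have "(\<Sum>n. f' n y) = - 2 * s * y * half_row_sum (Suc s) x y"
    unfolding f'_def half_row_sum_def by (rule suminf_mult, rule summable_half_row_sum) (use assms in auto)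
  ultimately show ?thesis by (simp add: f_def half_row_sum_def[abs_def])
qed

lemma has_field_derivative_row_sum:
  assumes "y > 0" "s \<ge> 1"
  shows "(row_sum s x has_field_derivative (- 2 * s * y * row_sum (Suc s) x y)) (at y)"
  unfolding row_sum_def[abs_def]
  by (rule derivative_eq_intros has_field_derivative_half_row_sum assms refl)+ (simp add: algebra_simps)

lemma summable_power_times_geometric:
  fixes q :: real
  assumes "\<bar>q\<bar> < 1"
  shows "summable (\<lambda>k. real k ^ j * q ^ k)"
  using assms
proof (induction j arbitrary: q)
  case 0
  thus ?case by (simp add: summable_geometric)
next
  case (Suc j)
  have "summable (\<lambda>k. diffs (\<lambda>k. real k ^ j) k * q ^ k)"
    by (rule termdiff_converges[where K = 1]) (use Suc in auto)
  hence "summable (\<lambda>k. q * (diffs (\<lambda>k. real k ^ j) k * q ^ k))"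
    by (rule summable_mult)
  also have "(\<lambda>k. q * (diffs (\<lambda>k. real k ^ j) k * q ^ k)) = (\<lambda>k. real (Suc k) ^ Suc j * q ^ Suc k)"
    by (auto simp: diffs_def algebra_simps)
  finally show ?case by (subst (asm) summable_Suc_iff)
qed

lemma summable_cos_power_geometric:
  fixes q :: real
  assumes "\<bar>q\<bar> < 1"
  shows "summable (\<lambda>k. cos (2 * pi * real k * x) * real k ^ j * q ^ k)"
proof (rule summable_comparison_test')
  show "summable (\<lambda>k. real k ^ j * \<bar>q\<bar> ^ k)"
    using assms by (intro summable_power_times_geometric) auto
  fix k :: nat
  have "\<bar>cos (2 * pi * k * x)\<bar> * (real k ^ j * \<bar>q\<bar> ^ k) \<le> 1 * (real k ^ j * \<bar>q\<bar> ^ k)"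
    by (intro mult_right_mono) auto
  thus "norm (cos (2 * pi * real k * x) * real k ^ j * q ^ k) \<le> real k ^ j * \<bar>q\<bar> ^ k"
    by (simp add: abs_mult power_abs)
qed

text \<open>The constant term of a Fourier cosine series counts only half of its \<open>k = 0\<close> coefficient.\<close>

definition cos_sum :: "nat \<Rightarrow> real \<Rightarrow> real \<Rightarrow> real" where
  "cos_sum j x y =
     (\<Sum>k. cos (2 * pi * real k * x) * real k ^ j * exp (- 2 * pi * y) ^ k) - (if j = 0 then 1 / 2 else 0)"

lemma has_field_derivative_cos_sum:
  assumes "y > 0"
  shows "(cos_sum j x has_field_derivative (- 2 * pi * cos_sum (Suc j) x y)) (at y)"
proof -
  define c where "c k = cos (2 * pi * real k * x) * real k ^ j" for k
  define q where "q = exp (- 2 * pi * y)"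
  have q: "0 < q" "q < 1" using assms by (auto simp: q_def)
  have summable: "summable (\<lambda>k. c k * u ^ k)" if "norm u < 1" for u :: real
    unfolding c_def using that by (intro summable_cos_power_geometric) auto
  have "summable (\<lambda>k. diffs c k * q ^ k)"
    by (rule termdiff_converges[where K = 1]) (use summable q in auto)
  from sums_mult[OF diffs_equiv[OF this], of q]
  have "(\<lambda>k. q * (real k * c k * q ^ (k - Suc 0))) sums (q * (\<Sum>k. diffs c k * q ^ k))" by simp
  moreover have "q * (real k * c k * q ^ (k - Suc 0))
      = cos (2 * pi * real k * x) * real k ^ Suc j * q ^ k" for k
    by (cases k) (auto simp: c_def)
  ultimately have "(\<lambda>k. cos (2 * pi * real k * x) * real k ^ Suc j * q ^ k)
      sums (q * (\<Sum>k. diffs c k * q ^ k))"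
    by (simp only:)
  hence series: "q * (\<Sum>k. diffs c k * q ^ k) = cos_sum (Suc j) x y"
    by (simp add: cos_sum_def q_def sums_iff)
  have "((\<lambda>u. \<Sum>k. c k * u ^ k) has_field_derivative (\<Sum>k. diffs c k * q ^ k)) (at q)"
    by (rule termdiffs_strong'[where K = 1]) (use summable q in auto)
  moreover have "((\<lambda>u. exp (- 2 * pi * u)) has_field_derivative (- 2 * pi * q)) (at y)"
    unfolding q_def by (auto intro!: derivative_eq_intros)
  ultimately have "((\<lambda>u. \<Sum>k. c k * exp (- 2 * pi * u) ^ k) has_field_derivative
      (\<Sum>k. diffs c k * q ^ k) * (- 2 * pi * q)) (at y)"
    unfolding q_def by (rule DERIV_chain2)
  hence "((\<lambda>u. (\<Sum>k. c k * exp (- 2 * pi * u) ^ k) - (if j = 0 then 1 / 2 else 0)) has_field_derivative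
      (\<Sum>k. diffs c k * q ^ k) * (- 2 * pi * q)) (at y)"
    by (auto intro!: derivative_eq_intros)
  moreover have "cos_sum j x = (\<lambda>u. (\<Sum>k. c k * exp (- 2 * pi * u) ^ k) - (if j = 0 then 1 / 2 else 0))"
    by (simp add: fun_eq_iff cos_sum_def c_def)
  moreover have "(\<Sum>k. diffs c k * q ^ k) * (- 2 * pi * q) = - 2 * pi * cos_sum (Suc j) x y"
    by (simp flip: series)
  ultimately show ?thesis by (simp only:)
qed

lemma Im_Digamma:
  assumes "Im z \<noteq> 0"
  shows "Im (Digamma z) = Im z * half_row_sum 1 (Re z) \<bar>Im z\<bar>"
proof -
  have "z \<noteq> 0" using assms by auto
  from sums_Im[OF summable_sums[OF summable_Digamma[OF this]]]
  have "(\<lambda>n. Im (inverse (of_nat (Suc n)) - inverse (z + of_nat n))) sums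
          Im (\<Sum>n. inverse (of_nat (Suc n)) - inverse (z + of_nat n))" .
  moreover have "Im (inverse (of_nat (Suc n)) - inverse (z + of_nat n))
      = Im z * (1 / ((Re z + n)\<^sup>2 + \<bar>Im z\<bar>\<^sup>2)) ^ 1" for n
  proof -
    have "Im (inverse (of_nat (Suc n) :: complex)) = 0"
      by (metis Im_complex_of_real of_real_inverse of_real_of_nat_eq)
    thus ?thesis by (simp del: of_nat_Suc)
  qed
  moreover have "Im (euler_mascheroni :: complex) = 0"
    by (metis Im_complex_of_real of_real_euler_mascheroni)
  ultimately have "(\<lambda>n. Im z * (1 / ((Re z + n)\<^sup>2 + \<bar>Im z\<bar>\<^sup>2)) ^ 1) sums Im (Digamma z)"
    by (simp only: Digamma_def) simp
  moreover have "(\<Sum>n. Im z * (1 / ((Re z + n)\<^sup>2 + \<bar>Im z\<bar>\<^sup>2)) ^ 1) = Im z * half_row_sum 1 (Re z) \<bar>Im z\<bar>"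
    unfolding half_row_sum_def using assms by (intro suminf_mult summable_half_row_sum) auto
  ultimately show ?thesis by (simp add: sums_iff)
qed

lemma Im_cot_eq_cos_sum:
  assumes "y > 0"
  shows "Im (cot (of_real pi * Complex x y)) = - 2 * cos_sum 0 x y"
proof -
  define q where "q = exp (2 * of_real pi * \<i> * Complex x y)"
  have norm_q: "norm q < 1" using assms by (simp add: q_def)
  have "Re (q ^ k) = cos (2 * pi * real k * x) * real k ^ 0 * exp (- 2 * pi * y) ^ k" for k
  proof -
    have "q ^ k = exp (of_nat k * (2 * of_real pi * \<i> * Complex x y))"
      by (simp add: q_def exp_of_nat_mult)
    thus ?thesis by (simp add: Re_exp exp_of_nat_mult[symmetric] algebra_simps)
  qed
  hence "Re (\<Sum>k. q ^ k) = (\<Sum>k. cos (2 * pi * real k * x) * real k ^ 0 * exp (- 2 * pi * y) ^ k)"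
    using sums_Re[OF summable_sums[OF summable_geometric[OF norm_q]]] by (simp add: sums_iff)
  thus ?thesis
    using cot_eq_geometric_series[of "Complex x y"] assms by (simp add: q_def cos_sum_def)
qed

lemma row_sum_1:
  assumes "y > 0"
  shows "y * row_sum 1 x y = 2 * pi * cos_sum 0 x y"
proof -
  define z where "z = Complex x y"
  have "z \<notin> \<int>" using assms complex_is_Int_iff[of z] by (auto simp: z_def)
  hence "Im (Digamma (1 - z) - Digamma z) = pi * Im (cot (of_real pi * z))"
    by (simp add: Digamma_reflection_complex)
  moreover have "Im (Digamma (1 - z) - Digamma z) = - y * row_sum 1 x y"
    using Im_Digamma[of z] Im_Digamma[of "1 - z"] assms by (simp add: z_def row_sum_def algebra_simps)
  ultimately show ?thesis
    using Im_cot_eq_cos_sum[OF assms] by (simp add: z_def)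
qed

text \<open>\<open>\<Sum>\<^sub>j bessel_coeff n j * (pi * y) ^ j * k ^ j\<close> is, up to a factor, the Bessel function of order
  \<open>n + 1 / 2\<close> in the \<open>k\<close>-th Fourier coefficient of row \<open>n + 1\<close>; the recursion is differentiation in \<open>y\<close>.\<close>

primrec bessel_coeff :: "nat \<Rightarrow> nat \<Rightarrow> real" where
  "bessel_coeff 0 j = (if j = 0 then 2 else 0)"
| "bessel_coeff (Suc n) j =
     ((2 * real n + 1 - real j) * bessel_coeff n j
       + (if j = 0 then 0 else 2 * bessel_coeff n (j - 1))) / (2 * (real n + 1))"

lemma bessel_coeff_eq_0: "n < j \<Longrightarrow> bessel_coeff n j = 0"
  by (induction n arbitrary: j) auto

lemma bessel_coeff_nonneg: "0 \<le> bessel_coeff n j"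
proof (induction n arbitrary: j)
  case (Suc n)
  have "0 \<le> (2 * real n + 1 - real j) * bessel_coeff n j"
    using Suc bessel_coeff_eq_0[of n j] by (cases "j \<le> n") auto
  thus ?case using Suc by (auto intro!: divide_nonneg_pos add_nonneg_nonneg simp: add_ac)
qed simp

lemma sum_bessel_coeff_Suc:
  "2 * (real n + 1) * (\<Sum>j\<le>Suc n. bessel_coeff (Suc n) j * f j)
     = (\<Sum>j\<le>n. bessel_coeff n j * ((2 * real n + 1 - real j) * f j + 2 * f (Suc j)))"
proof -
  have "2 * (real n + 1) * (bessel_coeff (Suc n) j * f j) =
      (2 * real n + 1 - real j) * bessel_coeff n j * f j
        + (if j = 0 then 0 else 2 * bessel_coeff n (j - 1) * f j)" for j
    by (simp add: field_simps)
  hence "2 * (real n + 1) * (\<Sum>j\<le>Suc n. bessel_coeff (Suc n) j * f j) =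
      (\<Sum>j\<le>Suc n. (2 * real n + 1 - real j) * bessel_coeff n j * f j)
      + (\<Sum>j\<le>Suc n. if j = 0 then 0 else 2 * bessel_coeff n (j - 1) * f j)"
    unfolding sum_distrib_left sum.distrib[symmetric] by (intro sum.cong) auto
  also have "(\<Sum>j\<le>Suc n. (2 * real n + 1 - real j) * bessel_coeff n j * f j)
      = (\<Sum>j\<le>n. (2 * real n + 1 - real j) * bessel_coeff n j * f j)"
    by (simp add: bessel_coeff_eq_0)
  also have "(\<Sum>j\<le>Suc n. if j = 0 then 0 else 2 * bessel_coeff n (j - 1) * f j)
      = (\<Sum>j\<le>n. 2 * bessel_coeff n j * f (Suc j))"
    by (subst sum.atMost_Suc_shift) simp
  also have "(\<Sum>j\<le>n. (2 * real n + 1 - real j) * bessel_coeff n j * f j) + \<dots>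
      = (\<Sum>j\<le>n. bessel_coeff n j * ((2 * real n + 1 - real j) * f j + 2 * f (Suc j)))"
    unfolding sum.distrib[symmetric] by (intro sum.cong refl) (simp add: algebra_simps)
  finally show ?thesis .
qed

definition bessel_cos_sum :: "nat \<Rightarrow> real \<Rightarrow> real \<Rightarrow> real" where
  "bessel_cos_sum n x y = (\<Sum>j\<le>n. bessel_coeff n j * ((pi * y) ^ j * cos_sum j x y))"

lemma has_field_derivative_bessel_cos_sum:
  assumes "y > 0"
  shows "(bessel_cos_sum n x has_field_derivative
    ((2 * real n + 1) * bessel_cos_sum n x y - 2 * (real n + 1) * bessel_cos_sum (Suc n) x y) / y) (at y)"
proof -
  define D where "D = (\<Sum>j\<le>n. bessel_coeff n j * (j * pi * (pi * y) ^ (j - 1) * cos_sum j x y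
      - (pi * y) ^ j * (2 * pi * cos_sum (Suc j) x y)))"
  have "((\<lambda>u. (pi * u) ^ j * cos_sum j x u) has_field_derivative
      j * pi * (pi * y) ^ (j - 1) * cos_sum j x y
        - (pi * y) ^ j * (2 * pi * cos_sum (Suc j) x y)) (at y)" for j
    using assms by (auto intro!: derivative_eq_intros has_field_derivative_cos_sum)
  hence deriv: "(bessel_cos_sum n x has_field_derivative D) (at y)"
    unfolding bessel_cos_sum_def[abs_def] D_def by (intro DERIV_cmult DERIV_sum)
  have "y * D = (\<Sum>j\<le>n. bessel_coeff n j *
      (j * ((pi * y) ^ j * cos_sum j x y) - 2 * ((pi * y) ^ Suc j * cos_sum (Suc j) x y)))"
    unfolding D_def sum_distrib_left
  proof (intro sum.cong refl)
    show "y * (bessel_coeff n j * (j * pi * (pi * y) ^ (j - 1) * cos_sum j x y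
          - (pi * y) ^ j * (2 * pi * cos_sum (Suc j) x y)))
      = bessel_coeff n j *
        (j * ((pi * y) ^ j * cos_sum j x y) - 2 * ((pi * y) ^ Suc j * cos_sum (Suc j) x y))" for j
      by (cases j) (simp_all add: algebra_simps)
  qed
  also have "\<dots> = (2 * real n + 1) * bessel_cos_sum n x y - (\<Sum>j\<le>n. bessel_coeff n j *
      ((2 * real n + 1 - real j) * ((pi * y) ^ j * cos_sum j x y) + 2 * ((pi * y) ^ Suc j * cos_sum (Suc j) x y)))"
    unfolding bessel_cos_sum_def sum_distrib_left sum_subtractf[symmetric]
    by (intro sum.cong refl) (simp add: algebra_simps)
  also have "\<dots> = (2 * real n + 1) * bessel_cos_sum n x y - 2 * (real n + 1) * bessel_cos_sum (Suc n) x y"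
    unfolding bessel_cos_sum_def sum_bessel_coeff_Suc[of n "\<lambda>j. (pi * y) ^ j * cos_sum j x y"] ..
  finally have "D = ((2 * real n + 1) * bessel_cos_sum n x y - 2 * (real n + 1) * bessel_cos_sum (Suc n) x y) / y"
    using assms by (simp only: eq_divide_eq) (simp add: mult.commute)
  with deriv show ?thesis by (simp only:)
qed

lemma row_sum_Suc_eq:
  assumes "y > 0" "s \<ge> 1" "\<And>u. u > 0 \<Longrightarrow> u ^ k * row_sum s x u = R u" "(R has_field_derivative R') (at y)"
  shows "2 * real s * y ^ (k + 2) * row_sum (Suc s) x y = k * R y - y * R'"
proof -
  have "((\<lambda>u. u ^ k * row_sum s x u) has_field_derivative
      k * y ^ (k - 1) * row_sum s x y + y ^ k * (- 2 * s * y * row_sum (Suc s) x y)) (at y)"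
    using DERIV_mult[OF DERIV_pow[of k y UNIV] has_field_derivative_row_sum[OF assms(1,2)]]
    by (simp add: mult_ac)
  hence "(R has_field_derivative
      k * y ^ (k - 1) * row_sum s x y + y ^ k * (- 2 * s * y * row_sum (Suc s) x y)) (at y)"
    by (rule has_field_derivative_transform_within_open[where S = "{0<..}"]) (use assms in auto)
  hence R': "R' = k * y ^ (k - 1) * row_sum s x y + y ^ k * (- 2 * s * y * row_sum (Suc s) x y)"
    using assms(4) by (rule DERIV_unique[symmetric])
  have R: "R y = y ^ k * row_sum s x y"
    using assms(1,3) by simp
  show ?thesis
    unfolding R R' by (cases k) (simp_all add: algebra_simps power2_eq_square)
qed

lemma row_sum_fourier:
  assumes "y > 0"
  shows "y ^ (2 * n + 1) * row_sum (Suc n) x y = pi * bessel_cos_sum n x y"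
  using assms
proof (induction n arbitrary: y)
  case 0
  thus ?case using row_sum_1 by (simp add: bessel_cos_sum_def)
next
  case (Suc n)
  let ?B = "\<lambda>k. bessel_cos_sum k x y"
  have "2 * real (Suc n) * y ^ (2 * n + 1 + 2) * row_sum (Suc (Suc n)) x y
      = real (2 * n + 1) * (pi * ?B n) - y * (pi * (((2 * real n + 1) * ?B n - 2 * (real n + 1) * ?B (Suc n)) / y))"
    by (rule row_sum_Suc_eq[OF Suc.prems _ Suc.IH DERIV_cmult[OF has_field_derivative_bessel_cos_sum]])
       (use Suc.prems in auto)
  also have "y * (pi * (((2 * real n + 1) * ?B n - 2 * (real n + 1) * ?B (Suc n)) / y))
      = pi * ((2 * real n + 1) * ?B n - 2 * (real n + 1) * ?B (Suc n))"
    using Suc.prems by simp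
  also have "real (2 * n + 1) * (pi * ?B n) - \<dots> = 2 * real (Suc n) * (pi * ?B (Suc n))"
    by (simp add: algebra_simps)
  finally show ?case by simp
qed

section \<open>Displacing a row\<close>

definition row_drop :: "nat \<Rightarrow> real \<Rightarrow> real \<Rightarrow> real" where
  "row_drop s x y = y ^ s * (row_sum s 0 y - row_sum s x y)"

definition fourier_coeff :: "nat \<Rightarrow> real \<Rightarrow> real \<Rightarrow> real" where
  "fourier_coeff s v k = (\<Sum>j<s. bessel_coeff (s - 1) j * pi ^ (j + 1) * k ^ j * v ^ (s - 1 - j))"

lemma fourier_coeff_3: "fourier_coeff 3 v k = pi ^ 3 * k ^ 2 + 3 / 2 * pi ^ 2 * k * v + 3 / 4 * pi * v ^ 2"
  by (simp add: fourier_coeff_def eval_nat_numeral field_simps)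

lemma fourier_coeff_6:
  "fourier_coeff 6 v k = 1 / 60 * pi ^ 6 * k ^ 5 + 1 / 8 * pi ^ 5 * k ^ 4 * v
     + 7 / 16 * pi ^ 4 * k ^ 3 * v ^ 2
     + 7 / 8 * pi ^ 3 * k ^ 2 * v ^ 3 + 63 / 64 * pi ^ 2 * k * v ^ 4 + 63 / 128 * pi * v ^ 5"
  by (simp add: fourier_coeff_def eval_nat_numeral field_simps)

lemma fourier_coeff_nonneg: "0 \<le> v \<Longrightarrow> 0 \<le> k \<Longrightarrow> 0 \<le> fourier_coeff s v k"
  unfolding fourier_coeff_def by (intro sum_nonneg mult_nonneg_nonneg bessel_coeff_nonneg) auto

lemma fourier_coeff_mono:
  assumes "0 \<le> v" "v \<le> w" "0 \<le> k"
  shows "fourier_coeff s v k \<le> fourier_coeff s w k"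
  unfolding fourier_coeff_def using assms
  by (intro sum_mono mult_left_mono power_mono mult_nonneg_nonneg bessel_coeff_nonneg) auto

lemma fourier_coeff_le_power_ratio:
  assumes "0 < l" "l \<le> k" "0 \<le> v"
  shows "fourier_coeff s v k \<le> (k / l) ^ (s - 1) * fourier_coeff s v l"
  unfolding fourier_coeff_def sum_distrib_left
proof (intro sum_mono)
  fix j assume j: "j \<in> {..<s}"
  have "k ^ j = (k / l) ^ j * l ^ j"
    using assms by (simp add: power_divide)
  also have "\<dots> \<le> (k / l) ^ (s - 1) * l ^ j"
    using assms j by (intro mult_right_mono power_increasing) auto
  finally have "bessel_coeff (s - 1) j * pi ^ (j + 1) * v ^ (s - 1 - j) * k ^ j
      \<le> bessel_coeff (s - 1) j * pi ^ (j + 1) * v ^ (s - 1 - j) * ((k / l) ^ (s - 1) * l ^ j)"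
    using assms by (intro mult_left_mono mult_nonneg_nonneg bessel_coeff_nonneg) auto
  thus "bessel_coeff (s - 1) j * pi ^ (j + 1) * k ^ j * v ^ (s - 1 - j)
      \<le> (k / l) ^ (s - 1) * (bessel_coeff (s - 1) j * pi ^ (j + 1) * l ^ j * v ^ (s - 1 - j))"
    by (simp only: mult_ac)
qed

lemma cos_sum_diff_sums:
  assumes "y > 0"
  shows "(\<lambda>k. real k ^ j * exp (- 2 * pi * y) ^ k * (1 - cos (2 * pi * real k * x)))
           sums (cos_sum j 0 y - cos_sum j x y)"
proof -
  have "(\<lambda>k. cos (2 * pi * real k * u) * real k ^ j * exp (- 2 * pi * y) ^ k) sums
      (cos_sum j u y + (if j = 0 then 1 / 2 else 0))" for u
    unfolding cos_sum_def diff_add_cancel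
    using assms by (intro summable_sums summable_cos_power_geometric) auto
  from sums_diff[OF this[of 0] this[of x]] show ?thesis by (simp add: algebra_simps)
qed

lemma row_drop_sums:
  assumes "y > 0" "s \<ge> 1"
  shows "(\<lambda>k. fourier_coeff s (1 / y) k * exp (- 2 * pi * y) ^ k * (1 - cos (2 * pi * real k * x)))
           sums row_drop s x y"
proof -
  obtain n where s: "s = Suc n" using assms(2) by (cases s) auto
  have coeff: "bessel_coeff n j * pi ^ (j + 1) * (1 / y) ^ (n - j)
      = (1 / y) ^ n * (pi * (bessel_coeff n j * (pi * y) ^ j))" if "j \<le> n" for j
    using that assms(1) by (simp add: power_mult_distrib power_diff power_one_over field_simps)
  have "(\<Sum>j\<le>n. bessel_coeff n j * pi ^ (j + 1) * (1 / y) ^ (n - j) * (cos_sum j 0 y - cos_sum j x y))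
      = (\<Sum>j\<le>n. (1 / y) ^ n * (pi * (bessel_coeff n j * (pi * y) ^ j)) * (cos_sum j 0 y - cos_sum j x y))"
    by (intro sum.cong refl) (simp only: coeff atMost_iff)
  also have "\<dots> = (1 / y) ^ n *
      (y ^ (2 * n + 1) * row_sum (Suc n) 0 y - y ^ (2 * n + 1) * row_sum (Suc n) x y)"
    unfolding row_sum_fourier[OF assms(1)] bessel_cos_sum_def
    by (simp add: sum_distrib_left sum_subtractf right_diff_distrib mult_ac)
  also have "\<dots> = (1 / y) ^ n * y ^ (2 * n + 1) * (row_sum s 0 y - row_sum s x y)"
    by (simp only: s right_diff_distrib mult.assoc)
  also have "(1 / y) ^ n * y ^ (2 * n + 1) = y ^ s"
    using assms by (simp add: s power_one_over mult_2 power_add)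
  finally have total:
    "(\<Sum>j\<le>n. bessel_coeff n j * pi ^ (j + 1) * (1 / y) ^ (n - j) * (cos_sum j 0 y - cos_sum j x y))
      = row_drop s x y"
    by (simp only: row_drop_def)
  have "(\<lambda>k. \<Sum>j\<le>n. bessel_coeff n j * pi ^ (j + 1) * (1 / y) ^ (n - j) *
          (real k ^ j * exp (- 2 * pi * y) ^ k * (1 - cos (2 * pi * real k * x)))) sums row_drop s x y"
    unfolding total[symmetric] by (intro sums_sum sums_mult cos_sum_diff_sums assms)
  moreover have "fourier_coeff s (1 / y) k * e * c
      = (\<Sum>j\<le>n. bessel_coeff n j * pi ^ (j + 1) * (1 / y) ^ (n - j) * (k ^ j * e * c))" for k e c
    unfolding fourier_coeff_def s lessThan_Suc_atMost sum_distrib_right by (intro sum.cong refl) simp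
  ultimately show ?thesis by (simp only:)
qed

lemma row_drop_minus:
  assumes "y > 0" "s \<ge> 1"
  shows "row_drop s (- x) y = row_drop s x y"
  using row_drop_sums[OF assms, of x] row_drop_sums[OF assms, of "- x"] by (simp add: sums_iff)

lemma row_drop_nonneg:
  assumes "y > 0" "s \<ge> 1"
  shows "0 \<le> row_drop s x y"
proof (rule sums_le[OF _ sums_zero row_drop_sums[OF assms]])
  show "0 \<le> fourier_coeff s (1 / y) (real k) * exp (- 2 * pi * y) ^ k *
      (1 - cos (2 * pi * real k * x))" for k
    using assms by (intro mult_nonneg_nonneg fourier_coeff_nonneg) auto
qed

lemma abs_sin_nat_mult_le: "\<bar>sin (real k * t)\<bar> \<le> real k * \<bar>sin t\<bar>"
proof (induction k)
  case (Suc k)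
  have "\<bar>sin (real (Suc k) * t)\<bar> = \<bar>sin (real k * t) * cos t + cos (real k * t) * sin t\<bar>"
    by (simp add: ring_distribs sin_add add_ac mult_ac)
  also have "\<dots> \<le> \<bar>sin (real k * t)\<bar> * \<bar>cos t\<bar> + \<bar>cos (real k * t)\<bar> * \<bar>sin t\<bar>"
    by (metis abs_mult abs_triangle_ineq)
  also have "\<dots> \<le> \<bar>sin (real k * t)\<bar> * 1 + 1 * \<bar>sin t\<bar>"
    by (intro add_mono mult_mono) auto
  finally show ?case using Suc by (simp add: ring_distribs)
qed simp

lemma one_minus_cos_eq: "1 - cos t = 2 * (sin (t / 2))\<^sup>2" for t :: real
  using cos_double_sin[of "t / 2"] by simp

lemma one_minus_cos_nat_mult_le: "1 - cos (real k * t) \<le> (real k)\<^sup>2 * (1 - cos t)"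
proof -
  have "\<bar>sin (real k * (t / 2))\<bar> ^ 2 \<le> (real k * \<bar>sin (t / 2)\<bar>) ^ 2"
    by (intro power_mono abs_sin_nat_mult_le) auto
  thus ?thesis unfolding one_minus_cos_eq by (simp add: power_mult_distrib)
qed

lemma one_minus_cos_twice: "1 - cos (2 * t) = (1 - cos t) * (4 - 2 * (1 - cos t))"
  for t :: real
  unfolding cos_double_cos by (simp add: power2_eq_square algebra_simps)

lemma one_minus_cos_thrice_le: "1 - cos (3 * t) \<le> (1 - cos t) * (9 - 4 * (1 - cos t))"
  for t :: real
proof -
  define r where "r = 1 - cos t"
  have r: "0 \<le> r" "r \<le> 2" using cos_ge_minus_one[of t] by (auto simp: r_def)
  have "1 - cos (3 * t) = r * (9 - 12 * r + 4 * r\<^sup>2)"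
    unfolding cos_treble_cos r_def by (simp add: power2_eq_square power3_eq_cube algebra_simps)
  also have "\<dots> \<le> r * (9 - 4 * r)"
  proof (intro mult_left_mono)
    have "r * r \<le> 2 * r" using r by (intro mult_right_mono) auto
    thus "9 - 12 * r + 4 * r\<^sup>2 \<le> 9 - 4 * r" by (simp add: power2_eq_square)
  qed (use r in auto)
  finally show ?thesis by (simp add: r_def)
qed

lemma row_drop_lower_bound:
  fixes x y :: real
  assumes "y > 0" "s \<ge> 1"
  defines "E \<equiv> exp (- 2 * pi * y)" and "r \<equiv> 1 - cos (2 * pi * x)"
  shows "fourier_coeff s (1 / y) 1 * E * r + fourier_coeff s (1 / y) 2 * E ^ 2 * (r * (4 - 2 * r))
           \<le> row_drop s x y"
proof -
  define d where "d k = fourier_coeff s (1 / y) k * E ^ k * (1 - cos (2 * pi * real k * x))" for k :: nat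
  have sums: "d sums row_drop s x y"
    unfolding d_def E_def by (rule row_drop_sums[OF assms(1,2)])
  have "d 1 + d 2 \<le> row_drop s x y"
    using sum_le_suminf[of d "{1,2}"] sums assms(1)
    by (simp add: sums_iff d_def E_def fourier_coeff_nonneg)
  moreover have "d 2 = fourier_coeff s (1 / y) 2 * E ^ 2 * (r * (4 - 2 * r))"
    using one_minus_cos_twice[of "2 * pi * x"] by (simp add: d_def r_def mult_ac)
  moreover have "d 1 = fourier_coeff s (1 / y) 1 * E * r" by (simp add: d_def r_def)
  ultimately show ?thesis by simp
qed

lemma power_ratio_le_geometric:
  assumes "0 < m" "m \<le> k"
  shows "(real k / real m) ^ p \<le> ((1 + 1 / real m) ^ p) ^ (k - m)"
proof -
  have "real k / real m = 1 + real (k - m) * (1 / real m)"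
    using assms by (simp add: of_nat_diff field_simps)
  also have "\<dots> \<le> (1 + 1 / real m) ^ (k - m)"
    by (rule Bernoulli_inequality) (rule order_trans[of _ 0], auto)
  finally have "(real k / real m) ^ p \<le> ((1 + 1 / real m) ^ (k - m)) ^ p"
    by (intro power_mono) auto
  thus ?thesis by (simp only: mult.commute flip: power_mult)
qed

lemma row_drop_term_le:
  fixes x v E :: real
  assumes "0 \<le> v" "0 \<le> E" "s \<ge> 1" "0 < m" "m \<le> k"
  defines "r \<equiv> 1 - cos (2 * pi * x)"
  shows "fourier_coeff s v k * E ^ k * (1 - cos (2 * pi * real k * x))
     \<le> (real m)\<^sup>2 * fourier_coeff s v m * E ^ m * r * ((1 + 1 / real m) ^ (s + 1) * E) ^ (k - m)"
proof -
  have r: "0 \<le> r" by (simp add: r_def)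
  have "1 - cos (2 * pi * real k * x) \<le> (real k)\<^sup>2 * r"
    using one_minus_cos_nat_mult_le[of k "2 * pi * x"] by (simp add: r_def mult_ac)
  hence "fourier_coeff s v k * E ^ k * (1 - cos (2 * pi * real k * x))
      \<le> ((real k / real m) ^ (s - 1) * fourier_coeff s v m) * E ^ k * ((real k)\<^sup>2 * r)"
    using assms(1-5) r by (intro mult_mono fourier_coeff_le_power_ratio
        mult_nonneg_nonneg fourier_coeff_nonneg) auto
  also have "(real k)\<^sup>2 = (real m)\<^sup>2 * (real k / real m)\<^sup>2"
    using assms(4) by (simp add: power_divide)
  also have "((real k / real m) ^ (s - 1) * fourier_coeff s v m) * E ^ k *
        ((real m)\<^sup>2 * (real k / real m)\<^sup>2 * r)
      = (real m)\<^sup>2 * fourier_coeff s v m * E ^ k * r * ((real k / real m) ^ (s - 1) * (real k / real m)\<^sup>2)"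
    by (simp only: mult_ac)
  also have "(real k / real m) ^ (s - 1) * (real k / real m)\<^sup>2 = (real k / real m) ^ (s + 1)"
    using assms(3) by (simp add: add.commute flip: power_add)
  also have "(real m)\<^sup>2 * fourier_coeff s v m * E ^ k * r * (real k / real m) ^ (s + 1)
      \<le> (real m)\<^sup>2 * fourier_coeff s v m * E ^ k * r * ((1 + 1 / real m) ^ (s + 1)) ^ (k - m)"
    using assms(1-5) r
    by (intro mult_left_mono power_ratio_le_geometric mult_nonneg_nonneg fourier_coeff_nonneg) auto
  also have "\<dots> = (real m)\<^sup>2 * fourier_coeff s v m * (E ^ m * E ^ (k - m)) * r *
      ((1 + 1 / real m) ^ (s + 1)) ^ (k - m)"
    using assms(5) by (simp flip: power_add)
  finally show ?thesis by (simp only: power_mult_distrib mult_ac)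
qed

lemma row_drop_upper_bound:
  fixes x y :: real
  assumes "y > 0" "s \<ge> 1"
  defines "E \<equiv> exp (- 2 * pi * y)" and "r \<equiv> 1 - cos (2 * pi * x)"
  defines "\<theta> \<equiv> (5 / 4) ^ (s + 1) * E"
  assumes \<theta>: "\<theta> < 1"
  shows "row_drop s x y
     \<le> fourier_coeff s (1 / y) 1 * E * r + fourier_coeff s (1 / y) 2 * E ^ 2 * (r * (4 - 2 * r))
       + fourier_coeff s (1 / y) 3 * E ^ 3 * (r * (9 - 4 * r))
       + 16 / (1 - \<theta>) * (fourier_coeff s (1 / y) 4 * E ^ 4 * r)"
proof -
  define d where "d k = fourier_coeff s (1 / y) k * E ^ k * (1 - cos (2 * pi * real k * x))" for k :: nat
  have E: "E > 0" by (simp add: E_def)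
  have sums: "d sums row_drop s x y"
    unfolding d_def E_def by (rule row_drop_sums[OF assms(1,2)])
  have tail: "summable (\<lambda>n. d (n + 4))" using sums by (simp add: sums_iff summable_ignore_initial_segment)
  have geometric: "(\<lambda>n. 16 * fourier_coeff s (1 / y) 4 * E ^ 4 * r * \<theta> ^ n) sums
      (16 * fourier_coeff s (1 / y) 4 * E ^ 4 * r * (1 / (1 - \<theta>)))"
    using E \<theta> by (intro sums_mult geometric_sums) (simp add: \<theta>_def abs_mult)
  have "d (n + 4) \<le> 16 * fourier_coeff s (1 / y) 4 * E ^ 4 * r * \<theta> ^ n" for n
    using row_drop_term_le[of "1 / y" E s 4 "n + 4" x] assms(1,2) E by (simp add: d_def r_def \<theta>_def)
  hence "(\<Sum>n. d (n + 4)) \<le> 16 / (1 - \<theta>) * (fourier_coeff s (1 / y) 4 * E ^ 4 * r)"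
    using suminf_le[OF _ tail sums_summable[OF geometric]] sums_unique[OF geometric] by simp
  moreover have "row_drop s x y = (\<Sum>n. d (n + 4)) + (d 1 + d 2 + d 3)"
    using sums suminf_split_initial_segment[of d 4] by (simp add: sums_iff eval_nat_numeral d_def)
  moreover have "d 2 = fourier_coeff s (1 / y) 2 * E ^ 2 * (r * (4 - 2 * r))"
    using one_minus_cos_twice[of "2 * pi * x"] by (simp add: d_def r_def mult_ac)
  moreover have "d 3 \<le> fourier_coeff s (1 / y) 3 * E ^ 3 * (r * (9 - 4 * r))"
    using one_minus_cos_thrice_le[of "2 * pi * x"] assms(1) E unfolding d_def r_def
    by (intro mult_mono mult_nonneg_nonneg fourier_coeff_nonneg) (auto simp: mult_ac)
  moreover have "d 1 = fourier_coeff s (1 / y) 1 * E * r" by (simp add: d_def r_def)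
  ultimately show ?thesis by linarith
qed

definition coeff_excess :: "real \<Rightarrow> real \<Rightarrow> real \<Rightarrow> real" where
  "coeff_excess b v k = fourier_coeff 6 v k - b * fourier_coeff 3 v k"

text \<open>Slope and curvature of the concave quadratic in \<open>\<rho> = (1 - cos 2\<pi>x) e\<^sup>-\<^sup>2\<^sup>\<pi>\<^sup>y\<close> that bounds
  \<open>row_drop 6 x y - b * row_drop 3 x y\<close>; the \<open>fourier_coeff 6\<close> terms absorb the frequencies \<open>k \<ge> 3\<close>.\<close>

definition excess_slope :: "real \<Rightarrow> real \<Rightarrow> real \<Rightarrow> real" where
  "excess_slope b v E = coeff_excess b v 1
     + E * (4 * coeff_excess b v 2 + 9 * E * fourier_coeff 6 v 3 + 17 * E\<^sup>2 * fourier_coeff 6 v 4)"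

definition excess_curvature :: "real \<Rightarrow> real \<Rightarrow> real \<Rightarrow> real" where
  "excess_curvature b v E = 2 * coeff_excess b v 2 + 4 * E * fourier_coeff 6 v 3"

lemma row_drop_excess_le:
  fixes x y :: real
  assumes "y > 0" "0 \<le> b"
  defines "E \<equiv> exp (- 2 * pi * y)" and "v \<equiv> 1 / y"
  defines "\<rho> \<equiv> (1 - cos (2 * pi * x)) * E"
  assumes E: "E \<le> 1 / 200"
  shows "row_drop 6 x y - b * row_drop 3 x y \<le> \<rho> * excess_slope b v E - \<rho>\<^sup>2 * excess_curvature b v E"
proof -
  define r where "r = 1 - cos (2 * pi * x)"
  have v: "0 \<le> v" using assms(1) by (simp add: v_def)
  have E_pos: "0 < E" by (simp add: E_def)
  define \<theta> where "\<theta> = (5 / 4) ^ (6 + 1) * E"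
  have \<theta>: "\<theta> < 1" "16 / (1 - \<theta>) \<le> 17" using E by (auto simp: \<theta>_def power_divide field_simps)
  have "row_drop 6 x y \<le> fourier_coeff 6 v 1 * E * r + fourier_coeff 6 v 2 * E ^ 2 * (r * (4 - 2 * r))
      + fourier_coeff 6 v 3 * E ^ 3 * (r * (9 - 4 * r)) + 16 / (1 - \<theta>) * (fourier_coeff 6 v 4 * E ^ 4 * r)"
    using row_drop_upper_bound[OF assms(1), of 6 x] \<theta>(1) unfolding E_def v_def r_def \<theta>_def by simp
  moreover have "16 / (1 - \<theta>) * (fourier_coeff 6 v 4 * E ^ 4 * r) \<le> 17 * (fourier_coeff 6 v 4 * E ^ 4 * r)"
    using \<theta>(2) v by (intro mult_right_mono mult_nonneg_nonneg fourier_coeff_nonneg) (auto simp: r_def)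
  moreover have "b * (fourier_coeff 3 v 1 * E * r + fourier_coeff 3 v 2 * E ^ 2 * (r * (4 - 2 * r)))
      \<le> b * row_drop 3 x y"
    using row_drop_lower_bound[OF assms(1), of 3 x] assms(2) unfolding E_def v_def r_def
    by (intro mult_left_mono) auto
  ultimately have "row_drop 6 x y - b * row_drop 3 x y
      \<le> fourier_coeff 6 v 1 * E * r + fourier_coeff 6 v 2 * E ^ 2 * (r * (4 - 2 * r))
        + fourier_coeff 6 v 3 * E ^ 3 * (r * (9 - 4 * r)) + 17 * (fourier_coeff 6 v 4 * E ^ 4 * r)
        - b * (fourier_coeff 3 v 1 * E * r + fourier_coeff 3 v 2 * E ^ 2 * (r * (4 - 2 * r)))"
    by linarith
  also have "\<dots> = \<rho> * excess_slope b v E - \<rho>\<^sup>2 * excess_curvature b v E"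
    unfolding excess_slope_def excess_curvature_def coeff_excess_def \<rho>_def r_def[symmetric] by algebra
  finally show ?thesis .
qed

section \<open>Numerical estimates for a row\<close>

lemma pi_power_bounds:
  "3.14159 \<le> pi" "pi \<le> 3.1416"
  "9.8696 \<le> pi ^ 2" "pi ^ 2 \<le> 9.8697"
  "31.0062 \<le> pi ^ 3" "pi ^ 3 \<le> 31.0064"
  "97.409 \<le> pi ^ 4" "pi ^ 4 \<le> 97.4092"
  "306.019 \<le> pi ^ 5" "pi ^ 5 \<le> 306.021"
  "961.388 \<le> pi ^ 6" "pi ^ 6 \<le> 961.391"
proof -
  have lower: "3.1415926 ^ k \<le> pi ^ k" for k using pi_approx by (intro power_mono) auto
  have upper: "pi ^ k \<le> 3.141593 ^ k" for k using pi_approx by (intro power_mono) auto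
  show "3.14159 \<le> pi" "9.8696 \<le> pi ^ 2" "31.0062 \<le> pi ^ 3" "97.409 \<le> pi ^ 4"
       "306.019 \<le> pi ^ 5" "961.388 \<le> pi ^ 6"
    using lower[of 1] lower[of 2] lower[of 3] lower[of 4] lower[of 5] lower[of 6]
    by (simp_all add: power_divide)
  show "pi \<le> 3.1416" "pi ^ 2 \<le> 9.8697" "pi ^ 3 \<le> 31.0064" "pi ^ 4 \<le> 97.4092"
       "pi ^ 5 \<le> 306.021" "pi ^ 6 \<le> 961.391"
    using upper[of 1] upper[of 2] upper[of 3] upper[of 4] upper[of 5] upper[of 6]
    by (simp_all add: power_divide)
qed

lemma exp_minus_2pi_le: "exp (- 2 * pi) \<le> 0.001868"
proof -
  have "(\<Sum>n\<in>{..<10}. (1.57 :: real) ^ n /\<^sub>R fact n) \<le> exp 1.57"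
    unfolding exp_def by (intro sum_le_suminf summable_exp_generic) auto
  hence "4.80661 \<le> exp (1.57 :: real)"
    by (simp add: eval_nat_numeral fact_numeral)
  hence "4.80661 * 1.000794 \<le> exp 1.57 * exp (pi / 2 - 1.57)"
    using exp_ge_add_one_self[of "pi / 2 - 1.57"] pi_approx by (intro mult_mono) auto
  also have "\<dots> = exp (pi / 2)" by (simp flip: exp_add)
  finally have "4.8104 ^ 4 \<le> exp (pi / 2) ^ 4" by (intro power_mono) auto
  also have "\<dots> = exp (2 * pi)" by (simp flip: exp_of_nat_mult)
  finally have "inverse (exp (2 * pi)) \<le> inverse (4.8104 ^ 4)" by (intro le_imp_inverse_le) auto
  also have "\<dots> \<le> 0.001868" by (simp add: power_divide)
  finally show ?thesis by (simp add: exp_minus)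
qed

lemma exp_minus_2pi_ge: "0.0018 \<le> exp (- 2 * pi)"
proof -
  have "exp (2 * pi - 6) \<le> 1 + (2 * pi - 6) + (2 * pi - 6)\<^sup>2"
    using pi_approx by (intro exp_bound) auto
  also have "\<dots> \<le> 1 + 0.2832 + 0.2832\<^sup>2"
    using pi_approx by (intro add_mono power_mono) auto
  finally have fraction: "exp (2 * pi - 6) \<le> 1.365" by (simp add: power2_eq_square)
  have "exp 1 ^ 6 \<le> (2.72 :: real) ^ 6" using e_less_272 by (intro power_mono) auto
  hence "exp 6 \<le> (406 :: real)" by (simp flip: exp_of_nat_mult add: power_divide)
  hence "exp 6 * exp (2 * pi - 6) \<le> 406 * 1.365" using fraction by (intro mult_mono) auto
  moreover have "exp (2 * pi) = exp 6 * exp (2 * pi - 6)" by (simp flip: exp_add)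
  ultimately have "inverse (406 * 1.365) \<le> inverse (exp (2 * pi))" by (intro le_imp_inverse_le) auto
  thus ?thesis by (simp add: exp_minus)
qed

lemma exp_le_cubic:
  fixes t :: real
  assumes "0 \<le> t" "t \<le> 0.842"
  shows "exp t \<le> 1 + t + t ^ 2 / 2 + 0.218 * t ^ 3"
proof -
  obtain u where u: "\<bar>u\<bar> \<le> \<bar>t\<bar>" "exp t = (\<Sum>m<5. t ^ m / fact m) + exp u / fact 5 * t ^ 5"
    using Maclaurin_exp_le by blast
  have "exp u \<le> exp 1" using u(1) assms by simp
  also have "\<dots> \<le> 2.72" using e_less_272 by simp
  finally have "exp t \<le> (\<Sum>m<5. t ^ m / fact m) + 2.72 / fact 5 * t ^ 5"
    unfolding u(2) using assms by (intro add_left_mono mult_right_mono divide_right_mono) auto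
  also have "\<dots> = 1 + t + t ^ 2 / 2 + (1 / 6 + t / 24 + 2.72 / 120 * t ^ 2) * t ^ 3"
    by (simp add: eval_nat_numeral field_simps)
  also have "\<dots> \<le> 1 + t + t ^ 2 / 2 + (1 / 6 + 0.842 / 24 + 2.72 / 120 * 0.842 ^ 2) * t ^ 3"
    using assms by (intro add_mono mult_mono power_mono order.refl) auto
  also have "\<dots> \<le> 1 + t + t ^ 2 / 2 + 0.218 * t ^ 3"
    using assms by (intro add_left_mono mult_right_mono) (auto simp: power2_eq_square)
  finally show ?thesis .
qed

definition exp_upper :: "real \<Rightarrow> real" where
  "exp_upper d = 0.001868 * (1 + 6.2832 * d + 19.74 * d ^ 2 + 54.1 * d ^ 3)"

lemma exp_minus_2pi_le_exp_upper:
  assumes "0 \<le> d" "d \<le> 0.134"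
  shows "exp (- 2 * pi * (1 - d)) \<le> exp_upper d"
proof -
  have "exp (2 * pi * d) \<le> exp (6.2832 * d)"
    unfolding exp_le_cancel_iff using pi_approx assms by (intro mult_right_mono) auto
  also have "\<dots> \<le> 1 + 6.2832 * d + (6.2832 * d) ^ 2 / 2 + 0.218 * (6.2832 * d) ^ 3"
    using assms by (intro exp_le_cubic) auto
  also have "\<dots> \<le> 1 + 6.2832 * d + 19.74 * d ^ 2 + 54.1 * d ^ 3"
    unfolding power_mult_distrib times_divide_eq_left[symmetric] mult.assoc[symmetric]
    using assms by (intro add_mono mult_right_mono order.refl) (auto simp: power_divide)
  finally have "exp (- 2 * pi) * exp (2 * pi * d)
      \<le> 0.001868 * (1 + 6.2832 * d + 19.74 * d ^ 2 + 54.1 * d ^ 3)"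
    using exp_minus_2pi_le by (intro mult_mono) auto
  moreover have "exp (- 2 * pi) * exp (2 * pi * d) = exp (- 2 * pi * (1 - d))"
    by (simp flip: exp_add add: algebra_simps)
  ultimately show ?thesis by (simp only: exp_upper_def)
qed

lemma exp_upper_bounds:
  assumes "0 \<le> d" "d \<le> 0.134"
  shows "0 \<le> exp_upper d" "exp_upper d \<le> 0.00435"
proof -
  show "0 \<le> exp_upper d" using assms(1) by (simp add: exp_upper_def)
  have "exp_upper d \<le> 0.001868 * (1 + 6.2832 * 0.134 + 19.74 * 0.134 ^ 2 + 54.1 * 0.134 ^ 3)"
    unfolding exp_upper_def using assms by (intro mult_left_mono add_mono power_mono order.refl) auto
  also have "\<dots> \<le> 0.00435" by (simp add: power_divide)
  finally show "exp_upper d \<le> 0.00435" .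
qed

lemma exp_minus_2pi_ge_linear:
  assumes "0 \<le> d"
  shows "0.0018 * (1 + 6.28 * d) \<le> exp (- 2 * pi * (1 - d))"
proof -
  have "6.28 * d \<le> 2 * pi * d"
    using pi_approx assms by (intro mult_right_mono) auto
  hence "1 + 6.28 * d \<le> exp (2 * pi * d)"
    using exp_ge_add_one_self[of "2 * pi * d"] by linarith
  hence "0.0018 * (1 + 6.28 * d) \<le> exp (- 2 * pi) * exp (2 * pi * d)"
    using exp_minus_2pi_ge assms by (intro mult_mono) auto
  also have "\<dots> = exp (- 2 * pi * (1 - d))" by (simp flip: exp_add add: algebra_simps)
  finally show ?thesis .
qed

lemma coeff_excess_eq:
  "coeff_excess b v k = (1 / 60 * pi ^ 6 * k ^ 5 - b * pi ^ 3 * k ^ 2)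
     + (1 / 8 * pi ^ 5 * k ^ 4 - 3 / 2 * b * pi ^ 2 * k) * v
     + (7 / 16 * pi ^ 4 * k ^ 3 - 3 / 4 * b * pi) * v ^ 2
     + 7 / 8 * pi ^ 3 * k ^ 2 * v ^ 3 + 63 / 64 * pi ^ 2 * k * v ^ 4 + 63 / 128 * pi * v ^ 5"
  unfolding coeff_excess_def fourier_coeff_3 fourier_coeff_6 by algebra

lemma coeff_excess_2_nonneg:
  assumes "0 \<le> b" "b \<le> 4" "0 \<le> v"
  shows "0 \<le> coeff_excess b v 2"
proof -
  have "b * pi ^ 3 \<le> 4 * 31.0064" "b * pi ^ 2 \<le> 4 * 9.8697" "pi * b \<le> 3.1416 * 4"
    using assms pi_power_bounds by (intro mult_mono; simp)+
  thus ?thesis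
    unfolding coeff_excess_eq using assms pi_power_bounds
    by (intro add_nonneg_nonneg mult_nonneg_nonneg) auto
qed

lemma excess_curvature_nonneg:
  assumes "0 \<le> b" "b \<le> 4" "0 \<le> v" "0 \<le> E"
  shows "0 \<le> excess_curvature b v E"
  unfolding excess_curvature_def using assms
  by (intro add_nonneg_nonneg mult_nonneg_nonneg coeff_excess_2_nonneg fourier_coeff_nonneg) auto

lemma excess_slope_le:
  assumes "0 \<le> b" "b \<le> 4" "0 \<le> v" "0 \<le> E" "E \<le> F" "F \<le> G"
  shows "excess_slope b v E \<le> coeff_excess b v 1
    + F * (4 * coeff_excess b v 2 + 9 * G * fourier_coeff 6 v 3 + 17 * G\<^sup>2 * fourier_coeff 6 v 4)"
  unfolding excess_slope_def using assms
  by (intro add_mono mult_mono power_mono order.refl add_nonneg_nonneg mult_nonneg_nonneg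
        coeff_excess_2_nonneg fourier_coeff_nonneg) auto

lemma coeff_excess_3_1_le:
  assumes "0 \<le> v" "v \<le> 1"
  shows "coeff_excess 3 v 1 \<le> - 9.1"
proof -
  have v_power: "v ^ k \<le> v" if "k \<ge> 1" for k
    using power_decreasing[OF that assms] by simp
  have "coeff_excess 3 v 1 \<le> (1 / 60 * pi ^ 6 * 1 ^ 5 - 3 * pi ^ 3 * 1 ^ 2)
      + (1 / 8 * pi ^ 5 * 1 ^ 4 - 3 / 2 * 3 * pi ^ 2 * 1) * v
      + (7 / 16 * pi ^ 4 * 1 ^ 3 - 3 / 4 * 3 * pi) * v
      + 7 / 8 * pi ^ 3 * 1 ^ 2 * v + 63 / 64 * pi ^ 2 * 1 * v + 63 / 128 * pi * v"
    unfolding coeff_excess_eq using pi_power_bounds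
    by (intro add_mono mult_left_mono v_power order.refl) auto
  also have "\<dots> = (1 / 60 * pi ^ 6 - 3 * pi ^ 3) + (1 / 8 * pi ^ 5 - 9 / 2 * pi ^ 2
      + (7 / 16 * pi ^ 4 - 9 / 4 * pi) + 7 / 8 * pi ^ 3 + 63 / 64 * pi ^ 2 + 63 / 128 * pi) * v"
    by (simp add: algebra_simps)
  also have "\<dots> \<le> (1 / 60 * pi ^ 6 - 3 * pi ^ 3) + (1 / 8 * pi ^ 5 - 9 / 2 * pi ^ 2
      + (7 / 16 * pi ^ 4 - 9 / 4 * pi) + 7 / 8 * pi ^ 3 + 63 / 64 * pi ^ 2 + 63 / 128 * pi) * 1"
    using pi_power_bounds assms(2) by (intro add_mono mult_left_mono order.refl) auto
  also have "\<dots> \<le> - 9.1" using pi_power_bounds by simp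
  finally show ?thesis .
qed

lemma coeff_excess_3_2_le:
  assumes "0 \<le> v" "v \<le> 1"
  shows "coeff_excess 3 v 2 \<le> 1129"
proof -
  have "coeff_excess 3 v 2 \<le> (1 / 60 * pi ^ 6 * 2 ^ 5 - 3 * pi ^ 3 * 2 ^ 2)
      + (1 / 8 * pi ^ 5 * 2 ^ 4 - 3 / 2 * 3 * pi ^ 2 * 2) * 1
      + (7 / 16 * pi ^ 4 * 2 ^ 3 - 3 / 4 * 3 * pi) * 1
      + 7 / 8 * pi ^ 3 * 2 ^ 2 * 1 + 63 / 64 * pi ^ 2 * 2 * 1 + 63 / 128 * pi * 1"
    unfolding coeff_excess_eq using pi_power_bounds assms
    by (intro add_mono mult_left_mono power_le_one order.refl) auto
  also have "\<dots> \<le> 1129" using pi_power_bounds by simp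
  finally show ?thesis .
qed

lemma excess_slope_3_nonpos:
  assumes "0 \<le> v" "v \<le> 1" "0 \<le> E" "E \<le> 0.001868"
  shows "excess_slope 3 v E \<le> 0"
proof -
  have third: "fourier_coeff 6 v 3 \<le> 8420" and fourth: "fourier_coeff 6 v 4 \<le> 30000"
    using fourier_coeff_mono[OF assms(1,2), of 3 6] fourier_coeff_mono[OF assms(1,2), of 4 6]
      pi_power_bounds
    by (simp_all add: fourier_coeff_6)
  have "excess_slope 3 v E \<le> coeff_excess 3 v 1 + 0.001868 *
      (4 * coeff_excess 3 v 2 + 9 * 0.001868 * fourier_coeff 6 v 3 + 17 * 0.001868\<^sup>2 * fourier_coeff 6 v 4)"
    using assms by (intro excess_slope_le) auto
  also have "\<dots> \<le> - 9.1 + 0.001868 * (4 * 1129 + 9 * 0.001868 * 8420 + 17 * 0.001868\<^sup>2 * 30000)"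
    by (intro add_mono mult_left_mono coeff_excess_3_1_le coeff_excess_3_2_le assms third fourth) auto
  also have "\<dots> \<le> 0" by (simp add: power_divide)
  finally show ?thesis .
qed

lemma row_drop_6_le_3:
  fixes x y :: real
  assumes "y \<ge> 1"
  shows "row_drop 6 x y \<le> 3 * row_drop 3 x y"
proof -
  define E where "E = exp (- 2 * pi * y)"
  define \<rho> where "\<rho> = (1 - cos (2 * pi * x)) * E"
  have "E \<le> exp (- 2 * pi)" unfolding E_def using assms by simp
  hence E: "0 \<le> E" "E \<le> 0.001868"
    using order_trans[OF _ exp_minus_2pi_le] by (auto simp: E_def)
  have "row_drop 6 x y - 3 * row_drop 3 x y
      \<le> \<rho> * excess_slope 3 (1 / y) E - \<rho>\<^sup>2 * excess_curvature 3 (1 / y) E"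
    unfolding \<rho>_def E_def by (rule row_drop_excess_le) (use assms E in \<open>auto simp: E_def\<close>)
  also have "\<dots> \<le> 0 - 0"
    using assms E by (intro diff_mono mult_nonneg_nonpos mult_nonneg_nonneg
        excess_slope_3_nonpos excess_curvature_nonneg) (auto simp: \<rho>_def)
  finally show ?thesis by simp
qed

section \<open>Rows of height between \<open>0.866\<close> and \<open>1\<close>\<close>

context
  fixes d v :: real
  assumes inverse: "v * (1 - d) = 1" and d_nonneg: "0 \<le> d" and d_le: "d \<le> 0.134"
begin

lemma d_powers_nonneg: "0 \<le> d ^ 2" "0 \<le> d ^ 3" "0 \<le> d ^ 4" "0 \<le> d ^ 5" "0 \<le> d ^ 6"
  using d_nonneg by simp_all

lemma inverse_one_minus_bounds: "1 \<le> v" "v \<le> 1.1548"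
proof -
  have "v = 1 / (1 - d)" using inverse d_le by (simp add: field_simps)
  thus "1 \<le> v" "v \<le> 1.1548" using d_nonneg d_le by (auto simp: pos_divide_le_eq)
qed

lemma inverse_one_minus_power_ge:
  "1 + d + d ^ 2 \<le> v"
  "1 + 2 * d + 3 * d ^ 2 \<le> v ^ 2"
  "1 + 3 * d + 6 * d ^ 2 \<le> v ^ 3"
  "1 + 4 * d + 10 * d ^ 2 \<le> v ^ 4"
  "1 + 5 * d + 15 * d ^ 2 \<le> v ^ 5"
proof -
  have remainders:
    "v - (1 + d + d ^ 2) = d ^ 3 * v"
    "v ^ 2 - (1 + 2 * d + 3 * d ^ 2) = d ^ 3 * (3 * v + v ^ 2)"
    "v ^ 3 - (1 + 3 * d + 6 * d ^ 2) = d ^ 3 * (6 * v + 3 * v ^ 2 + v ^ 3)"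
    "v ^ 4 - (1 + 4 * d + 10 * d ^ 2) = d ^ 3 * (10 * v + 6 * v ^ 2 + 3 * v ^ 3 + v ^ 4)"
    "v ^ 5 - (1 + 5 * d + 15 * d ^ 2) = d ^ 3 * (15 * v + 10 * v ^ 2 + 6 * v ^ 3 + 3 * v ^ 4 + v ^ 5)"
    using inverse by algebra+
  have nonneg: "0 \<le> v ^ k" for k using inverse_one_minus_bounds by simp
  show "1 + d + d ^ 2 \<le> v" "1 + 2 * d + 3 * d ^ 2 \<le> v ^ 2" "1 + 3 * d + 6 * d ^ 2 \<le> v ^ 3"
    "1 + 4 * d + 10 * d ^ 2 \<le> v ^ 4" "1 + 5 * d + 15 * d ^ 2 \<le> v ^ 5"
    by (subst diff_ge_0_iff_ge[symmetric], unfold remainders,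
        use d_nonneg inverse_one_minus_bounds nonneg in
          \<open>auto intro!: mult_nonneg_nonneg add_nonneg_nonneg\<close>)+
qed

lemma inverse_one_minus_power_le:
  "v \<le> 1 + d + d ^ 2 + 1.155 * d ^ 3"
  "v ^ 2 \<le> 1 + 2 * d + 3 * d ^ 2 + 4.8 * d ^ 3"
  "v ^ 3 \<le> 1 + 3 * d + 6 * d ^ 2 + 12.48 * d ^ 3"
  "v ^ 4 \<le> 1 + 4 * d + 10 * d ^ 2 + 25.97 * d ^ 3"
  "v ^ 5 \<le> 1 + 5 * d + 15 * d ^ 2 + 47.32 * d ^ 3"
proof -
  have remainders:
    "v = 1 + d + d ^ 2 + v * d ^ 3"
    "v ^ 2 = 1 + 2 * d + 3 * d ^ 2 + (3 * v + v ^ 2) * d ^ 3"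
    "v ^ 3 = 1 + 3 * d + 6 * d ^ 2 + (6 * v + 3 * v ^ 2 + v ^ 3) * d ^ 3"
    "v ^ 4 = 1 + 4 * d + 10 * d ^ 2 + (10 * v + 6 * v ^ 2 + 3 * v ^ 3 + v ^ 4) * d ^ 3"
    "v ^ 5 = 1 + 5 * d + 15 * d ^ 2 + (15 * v + 10 * v ^ 2 + 6 * v ^ 3 + 3 * v ^ 4 + v ^ 5) * d ^ 3"
    using inverse by algebra+
  have "v ^ k \<le> 1.1548 ^ k" for k using inverse_one_minus_bounds by (intro power_mono) auto
  from this[of 1] this[of 2] this[of 3] this[of 4] this[of 5]
  have powers: "v \<le> 1.1548" "v ^ 2 \<le> 1.3336" "v ^ 3 \<le> 1.5401" "v ^ 4 \<le> 1.7785" "v ^ 5 \<le> 2.0538"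
    by (auto simp: power_divide)
  show "v \<le> 1 + d + d ^ 2 + 1.155 * d ^ 3"
    by (subst remainders(1), intro add_left_mono mult_right_mono) (use powers d_nonneg in auto)
  show "v ^ 2 \<le> 1 + 2 * d + 3 * d ^ 2 + 4.8 * d ^ 3"
    by (subst remainders(2), intro add_left_mono mult_right_mono) (use powers d_nonneg in auto)
  show "v ^ 3 \<le> 1 + 3 * d + 6 * d ^ 2 + 12.48 * d ^ 3"
    by (subst remainders(3), intro add_left_mono mult_right_mono) (use powers d_nonneg in auto)
  show "v ^ 4 \<le> 1 + 4 * d + 10 * d ^ 2 + 25.97 * d ^ 3"
    by (subst remainders(4), intro add_left_mono mult_right_mono) (use powers d_nonneg in auto)
  show "v ^ 5 \<le> 1 + 5 * d + 15 * d ^ 2 + 47.32 * d ^ 3"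
    by (subst remainders(5), intro add_left_mono mult_right_mono) (use powers d_nonneg in auto)
qed

lemma coeff_excess_1_near_1_le:
  "coeff_excess 3.062 v 1 \<le> - 12.199 + 191.718 * d + 382.28 * d ^ 2 + 834.06 * d ^ 3"
proof -
  have "coeff_excess 3.062 v 1 \<le> - 78.917 + - 7.078 * v + 35.402 * v ^ 2 + 27.131 * v ^ 3
      + 9.716 * v ^ 4 + 1.547 * v ^ 5"
    unfolding coeff_excess_eq using pi_power_bounds inverse_one_minus_bounds
    by (intro add_mono mult_right_mono) auto
  also have "\<dots> \<le> - 12.199 + 191.718 * d + 382.28 * d ^ 2 + 834.06 * d ^ 3"
    by (simp, use inverse_one_minus_power_ge(1) inverse_one_minus_power_le(2-5)[simplified]
        d_nonneg d_powers_nonneg in linarith)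
  finally show ?thesis .
qed

lemma coeff_excess_2_near_1_ge: "1117.55 + 1599.8 * d + 2391.1 * d ^ 2 \<le> coeff_excess 3.062 v 2"
proof -
  have "1117.55 + 1599.8 * d + 2391.1 * d ^ 2
      \<le> 132.97 + 521.37 * v + 333.715 * v ^ 2 + 108.52 * v ^ 3 + 19.43 * v ^ 4 + 1.545 * v ^ 5"
    by (simp, use inverse_one_minus_power_ge d_nonneg d_powers_nonneg in linarith)
  also have "\<dots> \<le> coeff_excess 3.062 v 2"
    unfolding coeff_excess_eq using pi_power_bounds inverse_one_minus_bounds
    by (intro add_mono mult_right_mono) auto
  finally show ?thesis .
qed

lemma fourier_coeff_6_3_near_1_ge: "8416.75 + 6254.75 * d + 8326.25 * d ^ 2 \<le> fourier_coeff 6 v 3"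
proof -
  have "8416.75 + 6254.75 * d + 8326.25 * d ^ 2
      \<le> 3893.5 + 3098.25 * v + 1150.5 * v ^ 2 + 244 * v ^ 3 + 29 * v ^ 4 + 1.5 * v ^ 5"
    by (simp, use inverse_one_minus_power_ge d_nonneg d_powers_nonneg in linarith)
  also have "\<dots> \<le> fourier_coeff 6 v 3"
    unfolding fourier_coeff_6 using pi_power_bounds inverse_one_minus_bounds
    by (intro add_mono mult_right_mono) auto
  finally show ?thesis .
qed

lemma higher_coeffs_near_1_le:
  "4 * coeff_excess 3.062 v 2 + 9 * 0.00435 * fourier_coeff 6 v 3 + 17 * 0.00435\<^sup>2 * fourier_coeff 6 v 4
     \<le> 4810 + 6649.8 * d + 9897.8 * d ^ 2 + 17063.2 * d ^ 3"
proof -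
  have second: "coeff_excess 3.062 v 2
      \<le> 132.978 + 521.38 * v + 333.718 * v ^ 2 + 108.523 * v ^ 3 + 19.431 * v ^ 4 + 1.547 * v ^ 5"
    unfolding coeff_excess_eq using pi_power_bounds inverse_one_minus_bounds
    by (intro add_mono mult_right_mono) auto
  have third: "fourier_coeff 6 v 3 \<le> 3893.7 + 3098.5 * v + 1150.7 * v ^ 2 + 244.2 * v ^ 3 + 29.2 * v ^ 4
      + 1.55 * v ^ 5"
    unfolding fourier_coeff_6 using pi_power_bounds inverse_one_minus_bounds
    by (intro add_mono mult_right_mono) auto
  have fourth: "fourier_coeff 6 v 4 \<le> 16408 + 9793 * v + 2728 * v ^ 2 + 435 * v ^ 3 + 39 * v ^ 4
      + 1.55 * v ^ 5"
    unfolding fourier_coeff_6 using pi_power_bounds inverse_one_minus_bounds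
    by (intro add_mono mult_right_mono) auto
  show ?thesis
    by (simp add: power_divide, use second[simplified] third[simplified] fourth[simplified]
        inverse_one_minus_power_le[simplified] d_nonneg d_powers_nonneg in linarith)
qed

lemma exp_upper_mult_higher_coeffs_le:
  "exp_upper d * (4810 + 6649.8 * d + 9897.8 * d ^ 2 + 17063.2 * d ^ 3)
     \<le> 8.986 + 68.9 * d + 274 * d ^ 2 + 1079 * d ^ 3"
proof -
  have powers: "d ^ 4 \<le> 0.134 * d ^ 3" "d ^ 5 \<le> 0.134 * d ^ 4" "d ^ 6 \<le> 0.134 * d ^ 5"
    using d_nonneg mult_right_mono[OF d_le, of "d ^ 3"] mult_right_mono[OF d_le, of "d ^ 4"]
      mult_right_mono[OF d_le, of "d ^ 5"]
    by (auto simp flip: power_Suc)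
  have "exp_upper d * (4810 + 6649.8 * d + 9897.8 * d ^ 2 + 17063.2 * d ^ 3)
      = 0.001868 * (4810 + (6649.8 + 4810 * 6.2832) * d
        + (9897.8 + 6649.8 * 6.2832 + 4810 * 19.74) * d ^ 2
        + (17063.2 + 9897.8 * 6.2832 + 6649.8 * 19.74 + 4810 * 54.1) * d ^ 3
        + (17063.2 * 6.2832 + 9897.8 * 19.74 + 6649.8 * 54.1) * d ^ 4
        + (17063.2 * 19.74 + 9897.8 * 54.1) * d ^ 5 + 17063.2 * 54.1 * d ^ 6)"
    unfolding exp_upper_def by algebra
  also have "\<dots> \<le> 8.986 + 68.9 * d + 274 * d ^ 2 + 1079 * d ^ 3"
    by (simp, use powers[simplified] d_nonneg d_powers_nonneg in linarith)
  finally show ?thesis .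
qed

lemma excess_slope_near_1_le:
  "excess_slope 3.062 v (exp (- 2 * pi * (1 - d))) \<le> 2 * d * (118 + 470 * d)"
proof -
  note F = exp_upper_bounds[OF d_nonneg d_le]
  have "excess_slope 3.062 v (exp (- 2 * pi * (1 - d))) \<le> coeff_excess 3.062 v 1 + exp_upper d *
      (4 * coeff_excess 3.062 v 2 + 9 * 0.00435 * fourier_coeff 6 v 3
          + 17 * 0.00435\<^sup>2 * fourier_coeff 6 v 4)"
    using F(2) inverse_one_minus_bounds exp_minus_2pi_le_exp_upper[OF d_nonneg d_le]
    by (intro excess_slope_le) auto
  also have "\<dots> \<le> coeff_excess 3.062 v 1
      + exp_upper d * (4810 + 6649.8 * d + 9897.8 * d ^ 2 + 17063.2 * d ^ 3)"
    by (intro add_left_mono mult_left_mono higher_coeffs_near_1_le F(1))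
  also have "\<dots> \<le> (- 12.199 + 191.718 * d + 382.28 * d ^ 2 + 834.06 * d ^ 3)
      + (8.986 + 68.9 * d + 274 * d ^ 2 + 1079 * d ^ 3)"
    by (intro add_mono coeff_excess_1_near_1_le exp_upper_mult_higher_coeffs_le)
  also have "\<dots> \<le> 2 * d * (118 + 470 * d)"
  proof -
    have "d ^ 3 \<le> 0.134 * d ^ 2"
      using mult_right_mono[OF d_le, of "d ^ 2"] by (simp flip: power_Suc)
    moreover have "2 * 0.134 * d - 0.134 ^ 2 \<le> d ^ 2"
      using zero_le_power2[of "d - 0.134"] by (simp add: power2_eq_square algebra_simps)
    ultimately show ?thesis
      using d_nonneg d_le by (simp add: power2_eq_square algebra_simps)
  qed
  finally show ?thesis .
qed

lemma excess_curvature_near_1_ge: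
  "2295.7 + 3625 * d + 5124 * d ^ 2 \<le> excess_curvature 3.062 v (exp (- 2 * pi * (1 - d)))"
proof -
  define E where "E = exp (- 2 * pi * (1 - d))"
  have "15.15 + 106.35 * d + 85.45 * d ^ 2 \<le> 0.0018 * (8416.75 + (6254.75 + 6.28 * 8416.75) * d
      + (8326.25 + 6.28 * 6254.75) * d ^ 2 + 6.28 * 8326.25 * d ^ 3)"
    by (simp, use d_nonneg d_powers_nonneg in linarith)
  also have "\<dots> = 0.0018 * (1 + 6.28 * d) * (8416.75 + 6254.75 * d + 8326.25 * d ^ 2)" by algebra
  also have "\<dots> \<le> E * fourier_coeff 6 v 3"
    unfolding E_def using exp_minus_2pi_ge_linear[OF d_nonneg] fourier_coeff_6_3_near_1_ge d_nonneg
    by (intro mult_mono) auto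
  finally show ?thesis
    using coeff_excess_2_near_1_ge unfolding excess_curvature_def E_def[symmetric]
    by (simp add: mult.assoc)
qed

end

text \<open>Fitted numerically: \<open>d\<^sup>2 * descent_margin d\<close> exceeds the energy released by shifting the rows of
  the lattice of \<open>(1 - d)\<i>\<close> and stays below the energy needed to slide from \<open>\<i>\<close> down to \<open>(1 - d)\<i>\<close>.
  The line \<open>118 + 470 * d\<close> in the bound for the slope was fitted to make
  \<open>slope_square_le_curvature\<close> true, which is tightest near \<open>d = 0.115\<close>.\<close>

definition descent_margin :: "real \<Rightarrow> real" where
  "descent_margin d = 16.39 + 16.39 * d + 187 * d ^ 2 + 357 * d ^ 3 + 700 * d ^ 4"

lemma slope_square_le_curvature:
  fixes d :: real
  assumes "0 \<le> d" "d \<le> 0.134"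
  shows "2 * (118 + 470 * d)\<^sup>2 \<le> (2295.7 + 3625 * d + 5124 * d ^ 2) * descent_margin d"
proof -
  define a :: real where "a = 0.115"
  have "d ^ 2 - (2 * a * d - a ^ 2) = (d - a) ^ 2"
    "d ^ 3 - (3 * a ^ 2 * d - 2 * a ^ 3) = (d - a) ^ 2 * (d + 2 * a)"
    "d ^ 4 - (4 * a ^ 3 * d - 3 * a ^ 4) = (d - a) ^ 2 * (d ^ 2 + 2 * a * d + 3 * a ^ 2)"
    by algebra+
  moreover have "(d - a) ^ 2 \<ge> 0" "(d - a) ^ 2 * (d + 2 * a) \<ge> 0"
      "(d - a) ^ 2 * (d ^ 2 + 2 * a * d + 3 * a ^ 2) \<ge> 0"
    using assms by (auto simp: a_def intro!: mult_nonneg_nonneg add_nonneg_nonneg)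
  ultimately have tangents: "2 * a * d - a ^ 2 \<le> d ^ 2" "3 * a ^ 2 * d - 2 * a ^ 3 \<le> d ^ 3"
      "4 * a ^ 3 * d - 3 * a ^ 4 \<le> d ^ 4"
    by linarith+
  have "2 * (118 + 470 * d)\<^sup>2 = 27848 + 221840 * d + 441800 * d ^ 2" by algebra
  also have "\<dots> \<le> 2295.7 * 16.39 + (2295.7 * 16.39 + 3625 * 16.39) * d
       + (2295.7 * 187 + 3625 * 16.39 + 5124 * 16.39) * d ^ 2
       + (2295.7 * 357 + 3625 * 187 + 5124 * 16.39) * d ^ 3
       + (2295.7 * 700 + 3625 * 357 + 5124 * 187) * d ^ 4"
    using tangents assms by (simp add: a_def power_divide)
  also have "\<dots> \<le> \<dots> + ((3625 * 700 + 5124 * 357) * d ^ 5 + 5124 * 700 * d ^ 6)"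
    using assms by simp
  also have "\<dots> = (2295.7 + 3625 * d + 5124 * d ^ 2) * descent_margin d"
    unfolding descent_margin_def by algebra
  finally show ?thesis .
qed

lemma concave_quadratic_le:
  fixes t :: real
  assumes "0 < h" "a\<^sup>2 \<le> 4 * h * c"
  shows "t * a - t\<^sup>2 * h \<le> c"
proof -
  have "4 * h * (t * a - t\<^sup>2 * h) = a\<^sup>2 - (2 * h * t - a)\<^sup>2" by algebra
  also have "\<dots> \<le> 4 * h * c"
    using assms(2) zero_le_power2[of "2 * h * t - a"] by linarith
  finally show ?thesis using assms(1) by (simp add: mult_le_cancel_left_pos)
qed

lemma row_drop_excess_near_1_le:
  fixes x y :: real
  assumes "0.866 \<le> y" "y \<le> 1"
  defines "d \<equiv> 1 - y"
  shows "2 * (row_drop 6 x y - 3.062 * row_drop 3 x y) \<le> d\<^sup>2 * descent_margin d"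
proof -
  define E where "E = exp (- 2 * pi * y)"
  define \<rho> where "\<rho> = (1 - cos (2 * pi * x)) * E"
  define H where "H = excess_curvature 3.062 (1 / y) E"
  have d: "1 / y * (1 - d) = 1" "0 \<le> d" "d \<le> 0.134" "y = 1 - d" using assms by (auto simp: d_def)
  have powers: "0 \<le> d ^ k" for k using d by simp
  have "E \<le> 0.00435"
    using exp_minus_2pi_le_exp_upper[OF d(2,3)] exp_upper_bounds(2)[OF d(2,3)] by (simp add: E_def d(4))
  hence E: "E \<le> 1 / 200" by simp
  have H: "2295.7 + 3625 * d + 5124 * d ^ 2 \<le> H"
    using excess_curvature_near_1_ge[OF d(1-3)] by (simp add: H_def E_def d(4))
  hence H_pos: "0 < H" using d(2) powers[of 2] by linarith
  have "2 * (118 + 470 * d)\<^sup>2 \<le> (2295.7 + 3625 * d + 5124 * d ^ 2) * descent_margin d"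
    by (rule slope_square_le_curvature[OF d(2,3)])
  also have "\<dots> \<le> H * descent_margin d"
    using H powers d(2) by (intro mult_right_mono) (auto simp: descent_margin_def)
  finally have "2 * d\<^sup>2 * (2 * (118 + 470 * d)\<^sup>2) \<le> 2 * d\<^sup>2 * (H * descent_margin d)"
    by (rule mult_left_mono) simp
  also have "2 * d\<^sup>2 * (2 * (118 + 470 * d)\<^sup>2) = (2 * d * (118 + 470 * d))\<^sup>2" by algebra
  also have "2 * d\<^sup>2 * (H * descent_margin d) = 4 * H * (d\<^sup>2 * descent_margin d / 2)" by simp
  finally have maximum: "\<rho> * (2 * d * (118 + 470 * d)) - \<rho>\<^sup>2 * H \<le> d\<^sup>2 * descent_margin d / 2"
    by (rule concave_quadratic_le[OF H_pos])
  have "row_drop 6 x y - 3.062 * row_drop 3 x y \<le> \<rho> * excess_slope 3.062 (1 / y) E - \<rho>\<^sup>2 * H"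
    unfolding \<rho>_def E_def H_def by (rule row_drop_excess_le) (use assms E in \<open>auto simp: E_def\<close>)
  also have "\<dots> \<le> \<rho> * (2 * d * (118 + 470 * d)) - \<rho>\<^sup>2 * H"
    unfolding E_def d(4) using excess_slope_near_1_le[OF d(1-3)]
    by (intro diff_mono mult_left_mono order.refl) (auto simp: \<rho>_def E_def d(4))
  finally show ?thesis using maximum by simp
qed

section \<open>Lattice sums and their rows\<close>

definition lattice :: "(int \<times> int) set" where
  "lattice = UNIV - {(0, 0)}"

definition lattice_term :: "real \<Rightarrow> real \<Rightarrow> int \<times> int \<Rightarrow> real" where
  "lattice_term x y = (\<lambda>(m, n). y / ((m * x + n)\<^sup>2 + (m * y)\<^sup>2))"

definition lattice_sum :: "nat \<Rightarrow> real \<Rightarrow> real \<Rightarrow> real" where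
  "lattice_sum s x y = infsum (\<lambda>p. lattice_term x y p ^ s) lattice"

lemma epstein_zeta_eq_lattice_sum:
  assumes "Im z > 0"
  shows "epstein_zeta (real s) z = lattice_sum s (Re z) (Im z)"
  unfolding epstein_zeta_def lattice_sum_def lattice_def[symmetric]
proof (intro infsum_cong)
  fix p assume p: "p \<in> lattice"
  obtain m n where mn: "p = (m, n)" by (cases p)
  define w where "w = of_int m * z + of_int n"
  have "w \<noteq> 0"
  proof
    assume "w = 0"
    hence "Im w = 0" "Re w = 0" by auto
    thus False using p mn assms by (auto simp: w_def lattice_def)
  qed
  hence "cmod w powr (2 * real s) = ((cmod w)\<^sup>2) ^ s"
    by (simp add: powr_realpow flip: powr_powr)
  also have "(cmod w)\<^sup>2 = (m * Re z + n)\<^sup>2 + (m * Im z)\<^sup>2"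
    by (simp add: w_def cmod_power2)
  finally show "(case p of (m, n) \<Rightarrow> Im z powr real s / cmod (of_int m * z + of_int n) powr (2 * real s)) =
      lattice_term (Re z) (Im z) p ^ s"
    using assms by (simp add: mn lattice_term_def w_def power_divide powr_realpow)
qed

lemma lattice_term_nonneg: "y > 0 \<Longrightarrow> lattice_term x y p \<ge> 0"
  by (auto simp: lattice_term_def split: prod.split)

lemma lattice_norm_ge_1:
  assumes "(m, n) \<in> lattice"
  shows "1 \<le> (real_of_int m)\<^sup>2 + (real_of_int n)\<^sup>2"
proof -
  have "m\<^sup>2 + n\<^sup>2 \<noteq> 0" using assms by (simp add: lattice_def sum_power2_eq_zero_iff)
  moreover have "m\<^sup>2 + n\<^sup>2 \<ge> 0" by simp
  ultimately have "real_of_int 1 \<le> real_of_int (m\<^sup>2 + n\<^sup>2)" by (simp only: of_int_le_iff)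
  thus ?thesis by simp
qed

lemma has_sum_diff:
  fixes f g :: "'a \<Rightarrow> real"
  assumes "(f has_sum a) A" "(g has_sum b) A"
  shows "((\<lambda>x. f x - g x) has_sum (a - b)) A"
  using has_sum_add[OF assms(1) has_sum_uminusI[OF assms(2)]] by simp

lemma has_sum_int:
  fixes f :: "int \<Rightarrow> real"
  assumes "((\<lambda>n. f (int n)) has_sum a) UNIV" "((\<lambda>n. f (- 1 - int n)) has_sum b) UNIV"
  shows "(f has_sum (a + b)) UNIV"
proof -
  have "(f has_sum a) (range int)"
    using assms(1) by (subst has_sum_reindex) (auto simp: o_def)
  moreover have "(f has_sum b) (range (\<lambda>n. - 1 - int n))"
    using assms(2) by (subst has_sum_reindex) (auto simp: o_def inj_on_def)
  moreover have "range int \<inter> range (\<lambda>n. - 1 - int n) = {}" by auto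
  ultimately have "(f has_sum (a + b)) (range int \<union> range (\<lambda>n. - 1 - int n))"
    by (rule has_sum_Un_disjoint)
  moreover have "k \<in> range int \<union> range (\<lambda>n. - 1 - int n)" for k :: int
  proof (cases "k \<ge> 0")
    case True
    thus ?thesis using zero_le_imp_eq_int by blast
  next
    case False
    hence "k = - 1 - int (nat (- 1 - k))" by simp
    thus ?thesis by blast
  qed
  hence "range int \<union> range (\<lambda>n. - 1 - int n) = UNIV" by blast
  ultimately show ?thesis by simp
qed

lemma row_sum_has_sum:
  fixes x y :: real
  assumes "y > 0" "s \<ge> 1"
  shows "((\<lambda>n::int. (1 / ((x + n)\<^sup>2 + y\<^sup>2)) ^ s) has_sum row_sum s x y) UNIV"
  unfolding row_sum_def
proof (rule has_sum_int)
  have half: "((\<lambda>n. (1 / ((u + real n)\<^sup>2 + y\<^sup>2)) ^ s) has_sum half_row_sum s u y) UNIV" for u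
    using summable_sums[OF summable_half_row_sum[OF assms, of u]]
    by (intro sums_nonneg_imp_has_sum) (auto simp: half_row_sum_def)
  show "((\<lambda>n. (1 / ((x + real_of_int (int n))\<^sup>2 + y\<^sup>2)) ^ s) has_sum half_row_sum s x y) UNIV"
    using half[of x] by simp
  have "(x + real_of_int (- 1 - int n))\<^sup>2 = (1 - x + real n)\<^sup>2" for n
    by (simp add: power2_eq_square algebra_simps)
  thus "((\<lambda>n. (1 / ((x + real_of_int (- 1 - int n))\<^sup>2 + y\<^sup>2)) ^ s) has_sum half_row_sum s (1 - x) y) UNIV"
    using half[of "1 - x"] by simp
qed

lemma summable_square_lattice_term:
  assumes "s \<ge> 2"
  shows "(\<lambda>p. lattice_term 0 1 p ^ s) summable_on lattice"
proof -
  define h where "h n = 1 / (1 + (real_of_int n)\<^sup>2)" for n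
  have h: "(h has_sum row_sum 1 0 1) UNIV"
    using row_sum_has_sum[of 1 1 0] by (simp add: h_def[abs_def] add.commute)
  have "(\<lambda>(m, n). h m * h n) summable_on (UNIV \<times> UNIV)"
  proof (rule summable_on_SigmaI)
    show "((\<lambda>n. case (m, n) of (m, n) \<Rightarrow> h m * h n) has_sum (h m * row_sum 1 0 1)) UNIV" for m
      using has_sum_cmult_right[OF h] by simp
    show "(\<lambda>m. h m * row_sum 1 0 1) summable_on UNIV"
      using has_sum_cmult_left[OF h] by (rule has_sum_imp_summable)
  qed (auto simp: h_def)
  hence "(\<lambda>(m, n). h m * h n) summable_on lattice" by (rule summable_on_subset_banach) auto
  hence "(\<lambda>p. 3 * (case p of (m, n) \<Rightarrow> h m * h n)) summable_on lattice" by (rule summable_on_cmult_right)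
  thus ?thesis
  proof (rule summable_on_comparison_test)
    fix p assume p: "p \<in> lattice"
    obtain m n where mn: "p = (m, n)" by (cases p)
    define M where "M = (real_of_int m)\<^sup>2"
    define N where "N = (real_of_int n)\<^sup>2"
    have norm: "1 \<le> M + N" using lattice_norm_ge_1 p by (simp add: mn M_def N_def)
    have MN: "0 \<le> M" "0 \<le> N" by (auto simp: M_def N_def)
    have "M + N \<le> (M + N)\<^sup>2" "1 \<le> (M + N)\<^sup>2"
      using norm by (simp_all add: self_le_power one_le_power)
    moreover have "M * N \<le> (M + N)\<^sup>2"
      using MN by (simp add: power2_eq_square algebra_simps)
    ultimately have "(1 + M) * (1 + N) \<le> 3 * (M + N)\<^sup>2" by (simp add: algebra_simps)
    hence "(1 / (M + N))\<^sup>2 \<le> 3 * (1 / (1 + M) * (1 / (1 + N)))"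
      using MN norm by (simp add: power_divide divide_simps mult.commute)
    moreover have "(1 / (M + N)) ^ s \<le> (1 / (M + N))\<^sup>2"
      using norm assms by (intro power_decreasing) auto
    ultimately show "lattice_term 0 1 p ^ s \<le> 3 * (case p of (m, n) \<Rightarrow> h m * h n)"
      by (simp add: mn h_def M_def N_def lattice_term_def add.commute)
  qed (auto simp: lattice_term_nonneg)
qed

lemma lattice_term_le_square_lattice_term:
  assumes "a > 0"
  obtains C where "\<And>y p. y \<in> {a..c} \<Longrightarrow> lattice_term x y p \<le> C * lattice_term 0 1 p"
proof -
  obtain C where C: "C > 0" "\<And>m n y. y \<ge> a \<Longrightarrow> m\<^sup>2 + n\<^sup>2 \<le> C * ((m * x + n)\<^sup>2 + (m * y)\<^sup>2)"
    using quadratic_form_lower_bound[OF assms, of x] by blast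
  have "lattice_term x y p \<le> \<bar>c\<bar> * C * lattice_term 0 1 p" if y: "y \<in> {a..c}" for y p
  proof (cases "p \<in> lattice")
    case True
    obtain m n where mn: "p = (m, n)" by (cases p)
    define N where "N = (real_of_int m)\<^sup>2 + (real_of_int n)\<^sup>2"
    define Q where "Q = (m * x + n)\<^sup>2 + (m * y)\<^sup>2"
    have N: "1 \<le> N" using True lattice_norm_ge_1 by (simp add: mn N_def)
    have NQ: "N \<le> C * Q" using C(2)[of y m n] y by (simp add: N_def Q_def)
    hence Q: "0 < Q" using N C(1) zero_less_mult_pos[of C Q] by linarith
    have "y * N \<le> \<bar>c\<bar> * (C * Q)" using NQ N y assms by (intro mult_mono) auto
    hence "y / Q \<le> \<bar>c\<bar> * C * (1 / N)" using N Q by (simp add: field_simps)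
    thus ?thesis by (simp add: mn lattice_term_def N_def Q_def add.commute)
  qed (simp add: lattice_def lattice_term_def)
  thus thesis using that by blast
qed

lemma summable_lattice_term:
  assumes "y > 0" "s \<ge> 2"
  shows "(\<lambda>p. lattice_term x y p ^ s) summable_on lattice"
proof -
  obtain C where C: "\<And>p. lattice_term x y p \<le> C * lattice_term 0 1 p"
    using lattice_term_le_square_lattice_term[OF assms(1), of y x] by (metis atLeastAtMost_iff order.refl)
  have "(\<lambda>p. C ^ s * lattice_term 0 1 p ^ s) summable_on lattice"
    by (intro summable_on_cmult_right summable_square_lattice_term assms)
  thus ?thesis
  proof (rule summable_on_comparison_test)
    show "lattice_term x y p ^ s \<le> C ^ s * lattice_term 0 1 p ^ s" for p
      unfolding power_mult_distrib[symmetric] by (intro power_mono C lattice_term_nonneg assms)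
  qed (auto intro!: zero_le_power lattice_term_nonneg assms)
qed

lemma lattice_term_has_sum:
  assumes "y > 0" "s \<ge> 2"
  shows "((\<lambda>p. lattice_term x y p ^ s) has_sum lattice_sum s x y) lattice"
  unfolding lattice_sum_def by (rule has_sum_infsum[OF summable_lattice_term[OF assms]])

text \<open>The subtracted constant is the row \<open>m = 0\<close>, which does not depend on \<open>x\<close>.\<close>

lemma lattice_sum_rows:
  assumes "y > 0" "s \<ge> 2"
  shows "((\<lambda>m. y ^ s * row_sum s (of_int m * x) (of_int \<bar>m\<bar> * y)) has_sum
           (lattice_sum s x y - infsum (\<lambda>n. (y / (of_int n)\<^sup>2) ^ s) (- {0}))) (- {0})"
proof (rule has_sum_SigmaD)
  have "(\<lambda>p. lattice_term x y p ^ s) summable_on (Pair 0 ` (- {0}))"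
    by (rule summable_on_subset_banach[OF summable_lattice_term[OF assms]]) (auto simp: lattice_def)
  hence "((\<lambda>p. lattice_term x y p ^ s) has_sum infsum (\<lambda>n. (y / (of_int n)\<^sup>2) ^ s) (- {0}))
      (Pair 0 ` (- {0}))"
    by (simp add: has_sum_iff infsum_reindex inj_on_def o_def lattice_term_def)
  from has_sum_Diff[OF lattice_term_has_sum[OF assms] this]
  show "((\<lambda>p. lattice_term x y p ^ s) has_sum
      (lattice_sum s x y - infsum (\<lambda>n. (y / (of_int n)\<^sup>2) ^ s) (- {0}))) (Sigma (- {0}) (\<lambda>_. UNIV))"
    by (rule back_subst[of "\<lambda>A. (_ has_sum _) A"]) (auto simp: lattice_def)
  fix m :: int assume m: "m \<in> - {0}"
  have "((\<lambda>n::int. y ^ s * (1 / ((m * x + n)\<^sup>2 + (of_int \<bar>m\<bar> * y)\<^sup>2)) ^ s) has_sum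
      y ^ s * row_sum s (m * x) (of_int \<bar>m\<bar> * y)) UNIV"
    using m assms by (intro has_sum_cmult_right row_sum_has_sum) auto
  thus "((\<lambda>n. lattice_term x y (m, n) ^ s) has_sum y ^ s * row_sum s (m * x) (of_int \<bar>m\<bar> * y)) UNIV"
    by (simp add: lattice_term_def power_divide power_mult_distrib)
qed

lemma lattice_sum_diff_has_sum:
  assumes "y > 0" "s \<ge> 2"
  shows "((\<lambda>m. (1 / of_int \<bar>m\<bar>) ^ s * row_drop s (of_int m * x) (of_int \<bar>m\<bar> * y)) has_sum
           (lattice_sum s 0 y - lattice_sum s x y)) (- {0})"
proof -
  have "((\<lambda>m. y ^ s * row_sum s (of_int m * 0) (of_int \<bar>m\<bar> * y)
        - y ^ s * row_sum s (of_int m * x) (of_int \<bar>m\<bar> * y))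
      has_sum (lattice_sum s 0 y - lattice_sum s x y)) (- {0})"
    using has_sum_diff[OF lattice_sum_rows[OF assms, of 0] lattice_sum_rows[OF assms, of x]] by simp
  moreover have "y ^ s * row_sum s (of_int m * 0) (of_int \<bar>m\<bar> * y)
        - y ^ s * row_sum s (of_int m * x) (of_int \<bar>m\<bar> * y)
      = (1 / of_int \<bar>m\<bar>) ^ s * row_drop s (of_int m * x) (of_int \<bar>m\<bar> * y)" if "m \<in> - {0}" for m :: int
    using that
    by (simp add: row_drop_def power_mult_distrib power_one_over right_diff_distrib flip: power_abs)
  ultimately show ?thesis by (rule has_sum_cong[THEN iffD1, rotated])
qed

lemma lattice_sum_le_axis:
  assumes "y > 0" "s \<ge> 2"
  shows "lattice_sum s x y \<le> lattice_sum s 0 y"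
proof -
  have "0 \<le> lattice_sum s 0 y - lattice_sum s x y"
    using assms by (intro has_sum_nonneg[OF lattice_sum_diff_has_sum[OF assms]]
        mult_nonneg_nonneg row_drop_nonneg) auto
  thus ?thesis by simp
qed

lemma lattice_sum_diff_ge_row_drop:
  assumes "y > 0" "s \<ge> 2"
  shows "2 * row_drop s x y \<le> lattice_sum s 0 y - lattice_sum s x y"
proof -
  have "(\<Sum>m\<in>{1, - 1}. (1 / of_int \<bar>m\<bar>) ^ s * row_drop s (of_int m * x) (of_int \<bar>m\<bar> * y))
      \<le> lattice_sum s 0 y - lattice_sum s x y"
    using assms by (intro finite_sum_le_has_sum[OF lattice_sum_diff_has_sum]
        mult_nonneg_nonneg row_drop_nonneg) auto
  thus ?thesis using assms by (simp add: row_drop_minus)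
qed

lemma scaled_row_drop_6_le_3:
  fixes m :: int and x y :: real
  assumes "y > 0" "m \<noteq> 0" "1 \<le> of_int \<bar>m\<bar> * y"
  shows "(1 / of_int \<bar>m\<bar>) ^ 6 * row_drop 6 x (of_int \<bar>m\<bar> * y)
     \<le> 3 * ((1 / of_int \<bar>m\<bar>) ^ 3 * row_drop 3 x (of_int \<bar>m\<bar> * y))"
proof -
  have m: "1 \<le> real_of_int \<bar>m\<bar>" using assms(2) by linarith
  have "(1 / of_int \<bar>m\<bar>) ^ 6 * row_drop 6 x (of_int \<bar>m\<bar> * y)
      \<le> (1 / of_int \<bar>m\<bar>) ^ 6 * (3 * row_drop 3 x (of_int \<bar>m\<bar> * y))"
    using assms(3) by (intro mult_left_mono row_drop_6_le_3) auto
  also have "\<dots> \<le> (1 / of_int \<bar>m\<bar>) ^ 3 * (3 * row_drop 3 x (of_int \<bar>m\<bar> * y))"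
    using m assms(1) by (intro mult_right_mono power_decreasing mult_nonneg_nonneg row_drop_nonneg) auto
  finally show ?thesis by (simp only: mult.left_commute)
qed

lemma lattice_sum_diff_6_le_3:
  assumes "y \<ge> 1"
  shows "lattice_sum 6 0 y - lattice_sum 6 x y \<le> 3 * (lattice_sum 3 0 y - lattice_sum 3 x y)"
proof (rule has_sum_mono)
  show "((\<lambda>m. (1 / of_int \<bar>m\<bar>) ^ 6 * row_drop 6 (of_int m * x) (of_int \<bar>m\<bar> * y)) has_sum
      (lattice_sum 6 0 y - lattice_sum 6 x y)) (- {0})"
    using assms by (intro lattice_sum_diff_has_sum) auto
  show "((\<lambda>m. 3 * ((1 / of_int \<bar>m\<bar>) ^ 3 * row_drop 3 (of_int m * x) (of_int \<bar>m\<bar> * y))) has_sum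
      3 * (lattice_sum 3 0 y - lattice_sum 3 x y)) (- {0})"
    using assms by (intro has_sum_cmult_right lattice_sum_diff_has_sum) auto
  fix m :: int assume m: "m \<in> - {0}"
  hence "1 * 1 \<le> real_of_int \<bar>m\<bar> * y" using assms by (intro mult_mono) auto
  thus "(1 / of_int \<bar>m\<bar>) ^ 6 * row_drop 6 (of_int m * x) (of_int \<bar>m\<bar> * y)
      \<le> 3 * ((1 / of_int \<bar>m\<bar>) ^ 3 * row_drop 3 (of_int m * x) (of_int \<bar>m\<bar> * y))"
    using m assms by (intro scaled_row_drop_6_le_3) auto
qed

definition lattice_energy :: "real \<Rightarrow> real \<Rightarrow> real \<Rightarrow> real" where
  "lattice_energy b x y = lattice_sum 6 x y - b * lattice_sum 3 x y"

lemma lattice_energy_diff_near_1_le: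
  fixes x y :: real
  assumes "0.866 \<le> y" "y \<le> 1"
  defines "d \<equiv> 1 - y"
  shows "lattice_energy 3.062 0 y - lattice_energy 3.062 x y \<le> d\<^sup>2 * descent_margin d"
proof -
  have y: "y > 0" using assms by simp
  define excess where "excess m = (1 / of_int \<bar>m\<bar>) ^ 6 * row_drop 6 (of_int m * x) (of_int \<bar>m\<bar> * y)
      - 3.062 * ((1 / of_int \<bar>m\<bar>) ^ 3 * row_drop 3 (of_int m * x) (of_int \<bar>m\<bar> * y))" for m :: int
  have excess: "(excess has_sum
      ((lattice_sum 6 0 y - lattice_sum 6 x y) - 3.062 * (lattice_sum 3 0 y - lattice_sum 3 x y))) (- {0})"
    unfolding excess_def using y by (intro has_sum_diff has_sum_cmult_right lattice_sum_diff_has_sum) auto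
  have "excess m \<le> 0" if "m \<noteq> 0" "m \<notin> {1, - 1}" for m
  proof -
    have "2 * (1 / 2) \<le> real_of_int \<bar>m\<bar> * y" using that assms by (intro mult_mono) auto
    hence "(1 / of_int \<bar>m\<bar>) ^ 6 * row_drop 6 (of_int m * x) (of_int \<bar>m\<bar> * y)
        \<le> 3 * ((1 / of_int \<bar>m\<bar>) ^ 3 * row_drop 3 (of_int m * x) (of_int \<bar>m\<bar> * y))"
      using y that by (intro scaled_row_drop_6_le_3) auto
    also have "\<dots> \<le> 3.062 * ((1 / of_int \<bar>m\<bar>) ^ 3 * row_drop 3 (of_int m * x) (of_int \<bar>m\<bar> * y))"
      using y that by (intro mult_right_mono mult_nonneg_nonneg row_drop_nonneg) auto
    finally show ?thesis by (simp add: excess_def)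
  qed
  hence "(lattice_sum 6 0 y - lattice_sum 6 x y) - 3.062 * (lattice_sum 3 0 y - lattice_sum 3 x y)
      \<le> sum excess {1, - 1}"
    by (intro has_sum_mono_neutral[OF excess has_sum_finite]) auto
  also have "\<dots> = 2 * (row_drop 6 x y - 3.062 * row_drop 3 x y)"
    using y by (simp add: excess_def row_drop_minus)
  also have "\<dots> \<le> d\<^sup>2 * descent_margin d"
    unfolding d_def by (rule row_drop_excess_near_1_le[OF assms(1,2)])
  finally show ?thesis by (simp add: lattice_energy_def right_diff_distrib)
qed

lemma continuous_on_lattice_sum:
  assumes "s \<ge> 2"
  shows "continuous_on {0<..} (lattice_sum s x)"
proof -
  have "continuous_on {a..c} (lattice_sum s x)" if "a > 0" for a c
  proof -
    obtain C where C: "\<And>y p. y \<in> {a..c} \<Longrightarrow> lattice_term x y p \<le> C * lattice_term 0 1 p"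
      using lattice_term_le_square_lattice_term[OF \<open>a > 0\<close>] by blast
    have "uniform_limit {a..c} (\<lambda>X y. \<Sum>p\<in>X. lattice_term x y p ^ s)
            (\<lambda>y. \<Sum>\<^sub>\<infinity>p\<in>lattice. lattice_term x y p ^ s) (finite_subsets_at_top lattice)"
    proof (rule Weierstrass_m_test_general)
      show "(\<lambda>p. (C * lattice_term 0 1 p) ^ s) summable_on lattice"
        unfolding power_mult_distrib by (intro summable_on_cmult_right summable_square_lattice_term assms)
      show "norm (lattice_term x y p ^ s) \<le> (C * lattice_term 0 1 p) ^ s" if "y \<in> {a..c}" for y p
        unfolding norm_power using that \<open>a > 0\<close> C lattice_term_nonneg[of y x p] by (intro power_mono) auto
    qed
    moreover have "continuous_on {a..c} (\<lambda>y. lattice_term x y p ^ s)" if "p \<in> lattice" for p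
    proof -
      obtain m n where mn: "p = (m, n)" by (cases p)
      have "(m * x + n)\<^sup>2 + (m * y)\<^sup>2 \<noteq> 0" if "y \<in> {a..c}" for y :: real
        using that \<open>a > 0\<close> \<open>p \<in> lattice\<close> by (auto simp: mn lattice_def sum_power2_eq_zero_iff)
      thus ?thesis unfolding mn lattice_term_def prod.case by (intro continuous_intros) auto
    qed
    hence "eventually (\<lambda>X. continuous_on {a..c} (\<lambda>y. \<Sum>p\<in>X. lattice_term x y p ^ s))
        (finite_subsets_at_top lattice)"
      by (intro eventually_finite_subsets_at_top_weakI continuous_on_sum) auto
    ultimately have "continuous_on {a..c} (\<lambda>y. \<Sum>\<^sub>\<infinity>p\<in>lattice. lattice_term x y p ^ s)"
      by (intro uniform_limit_theorem[rotated]) auto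
    thus ?thesis by (simp add: lattice_sum_def[abs_def])
  qed
  hence "isCont (lattice_sum s x) y" if "y > 0" for y
    using that continuous_on_interior[of "{y / 2..2 * y}" "lattice_sum s x" y] by simp
  thus ?thesis by (simp add: continuous_at_imp_continuous_on)
qed

section \<open>The imaginary axis\<close>

lemma convex_on_inverse_power: "convex_on {0<..} (\<lambda>t::real. (1 / t) ^ n)"
proof (rule f''_ge0_imp_convex)
  fix t :: real assume t: "t \<in> {0<..}"
  have deriv: "((\<lambda>t. (1 / t) ^ k) has_field_derivative - (real k * (1 / t) ^ Suc k)) (at t)" for k
  proof (cases k)
    case (Suc j)
    have "((\<lambda>t. 1 / t) has_field_derivative - ((1 / t) * (1 / t))) (at t)"
      using t by (auto intro!: derivative_eq_intros)
    from DERIV_power[OF this, of k] show ?thesis by (simp add: Suc algebra_simps)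
  qed simp
  show "((\<lambda>t. (1 / t) ^ n) has_field_derivative - (real n * (1 / t) ^ Suc n)) (at t)"
    by (rule deriv)
  show "((\<lambda>t. - (real n * (1 / t) ^ Suc n)) has_field_derivative
      real n * (real (Suc n) * (1 / t) ^ Suc (Suc n))) (at t)"
    using DERIV_minus[OF DERIV_cmult[OF deriv[of "Suc n"], of "real n"]] by simp
  show "0 \<le> real n * (real (Suc n) * (1 / t) ^ Suc (Suc n))"
    using t by simp
qed simp

lemma weighted_inverse_power_le:
  fixes a b M N :: real
  assumes "M \<ge> 0" "N \<ge> 0" "M + N > 0" "a > 0" "b > 0"
  shows "(1 / (M * a + N * b)) ^ n
    \<le> (1 / (M + N)) ^ n * (M / (M + N) * (1 / a) ^ n + N / (M + N) * (1 / b) ^ n)"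
proof -
  define t where "t = N / (M + N)"
  have t: "0 \<le> t" "t \<le> 1" "1 - t = M / (M + N)" using assms by (auto simp: t_def field_simps)
  have "(1 / ((1 - t) * a + t * b)) ^ n \<le> (1 - t) * (1 / a) ^ n + t * (1 / b) ^ n"
    using convex_onD[OF convex_on_inverse_power t(1,2), of a b n] assms by simp
  hence "(1 / (M + N)) ^ n * (1 / ((1 - t) * a + t * b)) ^ n
      \<le> (1 / (M + N)) ^ n * ((1 - t) * (1 / a) ^ n + t * (1 / b) ^ n)"
    using assms by (intro mult_left_mono) auto
  moreover have "M * a + N * b = (M + N) * ((1 - t) * a + t * b)"
    using assms unfolding t(3) by (simp add: t_def distrib_left)
  ultimately show ?thesis
    unfolding t(3) by (simp add: t_def power_mult_distrib[symmetric])
qed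

lemma swapped_inverse_powers_le:
  fixes a b M N :: real
  assumes "M \<ge> 0" "N \<ge> 0" "M + N > 0" "a > 0" "b > 0"
  shows "(1 / (M * a + N * b)) ^ n + (1 / (N * a + M * b)) ^ n
      \<le> ((1 / a) ^ n + (1 / b) ^ n) * (1 / (M + N)) ^ n"
proof -
  have "(1 / (M * a + N * b)) ^ n + (1 / (N * a + M * b)) ^ n
      \<le> (1 / (M + N)) ^ n * (M / (M + N) * (1 / a) ^ n + N / (M + N) * (1 / b) ^ n)
        + (1 / (N + M)) ^ n * (N / (N + M) * (1 / a) ^ n + M / (N + M) * (1 / b) ^ n)"
    using assms by (intro add_mono weighted_inverse_power_le) auto
  also have "\<dots> = (M / (M + N) + N / (M + N)) * (((1 / a) ^ n + (1 / b) ^ n) * (1 / (M + N)) ^ n)"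
    by (simp only: add.commute[of N M] distrib_left distrib_right mult_ac add_ac)
  also have "M / (M + N) + N / (M + N) = 1"
    using assms by (simp flip: add_divide_distrib)
  finally show ?thesis by simp
qed

lemma swapped_inverse_powers_ge:
  fixes a b M N :: real
  assumes "M \<ge> 0" "N \<ge> 0" "M + N > 0" "a > 0" "b > 0"
  shows "2 * ((2 / (a + b)) ^ n * (1 / (M + N)) ^ n)
      \<le> (1 / (M * a + N * b)) ^ n + (1 / (N * a + M * b)) ^ n"
proof -
  define u where "u = M * a + N * b"
  define w where "w = N * a + M * b"
  have "M > 0 \<or> N > 0" using assms by linarith
  hence pos: "u > 0" "w > 0"
    using assms by (auto simp: u_def w_def intro: add_pos_nonneg add_nonneg_pos)
  have "(1 / (1 * u + 1 * w)) ^ n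
      \<le> (1 / (1 + 1)) ^ n * (1 / (1 + 1) * (1 / u) ^ n + 1 / (1 + 1) * (1 / w) ^ n)"
    using pos by (intro weighted_inverse_power_le) auto
  hence "2 * (2 ^ n * (1 / (u + w)) ^ n) \<le> (1 / u) ^ n + (1 / w) ^ n"
    by (simp add: power_one_over field_simps)
  moreover have "u + w = (a + b) * (M + N)" by (simp add: u_def w_def algebra_simps)
  hence "2 ^ n * (1 / (u + w)) ^ n = (2 / (a + b)) ^ n * (1 / (M + N)) ^ n"
    by (simp flip: power_mult_distrib)
  ultimately show ?thesis by (simp add: u_def w_def)
qed

definition power_pair :: "nat \<Rightarrow> real \<Rightarrow> real" where
  "power_pair s y = y ^ s + (1 / y) ^ s"

definition inverse_mean :: "real \<Rightarrow> real" where
  "inverse_mean y = 2 / (y + 1 / y)"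

lemma power_pair_ge_2:
  assumes "y > 0"
  shows "2 \<le> power_pair s y"
proof -
  define u where "u = y ^ s"
  have u: "u > 0" using assms by (simp add: u_def)
  have "2 * u \<le> u * u + 1" using zero_le_power2[of "u - 1"] by (simp add: power2_eq_square algebra_simps)
  hence "2 \<le> u + 1 / u" using u by (simp add: field_simps)
  thus ?thesis by (simp add: power_pair_def u_def power_divide)
qed

lemma power_pair_double:
  assumes "y \<noteq> 0"
  shows "power_pair (2 * s) y = (power_pair s y)\<^sup>2 - 2"
proof -
  have "y ^ s * (1 / y) ^ s = 1" using assms by (simp flip: power_mult_distrib)
  thus ?thesis unfolding power_pair_def mult.commute[of 2] power_mult power2_sum by (simp only: mult.assoc)
qed

lemma inverse_mean_bounds:
  assumes "y > 0"
  shows "0 \<le> inverse_mean y" "inverse_mean y \<le> 1"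
  using power_pair_ge_2[OF assms, of 1] by (auto simp: inverse_mean_def power_pair_def)

lemma lattice_term_axis:
  assumes "y > 0"
  shows "lattice_term 0 y (m, n) = 1 / ((real_of_int m)\<^sup>2 * y + (real_of_int n)\<^sup>2 * (1 / y))"
  using assms by (simp add: lattice_term_def field_simps power2_eq_square)

lemma lattice_term_swap_le:
  assumes "y > 0" "p \<in> lattice"
  shows "lattice_term 0 y p ^ s + lattice_term 0 y (prod.swap p) ^ s
      \<le> power_pair s y * lattice_term 0 1 p ^ s"
proof -
  obtain m n where mn: "p = (m, n)" by (cases p)
  have "1 \<le> (real_of_int m)\<^sup>2 + (real_of_int n)\<^sup>2" using lattice_norm_ge_1 assms mn by simp
  thus ?thesis
    using swapped_inverse_powers_le[of "(real_of_int m)\<^sup>2" "(real_of_int n)\<^sup>2" y "1 / y" s] assms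
    by (simp add: mn lattice_term_axis power_pair_def add.commute)
qed

lemma lattice_term_swap_ge:
  assumes "y > 0" "p \<in> lattice"
  shows "2 * inverse_mean y ^ s * lattice_term 0 1 p ^ s
      \<le> lattice_term 0 y p ^ s + lattice_term 0 y (prod.swap p) ^ s"
proof -
  obtain m n where mn: "p = (m, n)" by (cases p)
  have "1 \<le> (real_of_int m)\<^sup>2 + (real_of_int n)\<^sup>2" using lattice_norm_ge_1 assms mn by simp
  thus ?thesis
    using swapped_inverse_powers_ge[of "(real_of_int m)\<^sup>2" "(real_of_int n)\<^sup>2" y "1 / y" s] assms
    by (simp add: mn lattice_term_axis inverse_mean_def)
qed

lemma lattice_sum_swap_has_sum:
  assumes "y > 0" "s \<ge> 2"
  shows "((\<lambda>p. lattice_term x y p ^ s + lattice_term x y (prod.swap p) ^ s)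
      has_sum (2 * lattice_sum s x y)) lattice"
proof -
  have "bij_betw prod.swap lattice lattice"
    by (rule bij_betw_byWitness[where f' = prod.swap]) (auto simp: lattice_def)
  hence "((\<lambda>p. lattice_term x y (prod.swap p) ^ s) has_sum lattice_sum s x y) lattice"
    using has_sum_reindex_bij_betw[of prod.swap lattice lattice "\<lambda>p. lattice_term x y p ^ s"]
      lattice_term_has_sum[OF assms] by simp
  from has_sum_add[OF lattice_term_has_sum[OF assms, of x] this] show ?thesis by simp
qed

lemma has_sum_le_outside_finite:
  fixes f g :: "'a \<Rightarrow> real"
  assumes "(f has_sum a) A" "(g has_sum b) A" "finite B" "B \<subseteq> A" "\<And>x. x \<in> A - B \<Longrightarrow> f x \<le> g x"
  shows "a - sum f B \<le> b - sum g B"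
  by (rule has_sum_mono[OF has_sum_Diff[OF assms(1)] has_sum_Diff[OF assms(2)]])
     (use assms in \<open>auto intro: has_sum_finite\<close>)

definition unit_vectors :: "(int \<times> int) set" where
  "unit_vectors = {(1, 0), (- 1, 0), (0, 1), (0, - 1)}"

definition diagonal_vectors :: "(int \<times> int) set" where
  "diagonal_vectors = {(1, 1), (1, - 1), (- 1, 1), (- 1, - 1)}"

lemma unit_vectors_subset_lattice: "finite unit_vectors" "unit_vectors \<subseteq> lattice"
  by (auto simp: unit_vectors_def lattice_def)

lemma diagonal_vectors_subset_lattice: "finite diagonal_vectors" "diagonal_vectors \<subseteq> lattice"
  by (auto simp: diagonal_vectors_def lattice_def)

lemma lattice_sum_axis_le:
  assumes "y > 0" "s \<ge> 2"
  shows "lattice_sum s 0 y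
    \<le> power_pair s y / 2 * (lattice_sum s 0 1 - 4 * (1 / 2) ^ s) + 4 * (inverse_mean y / 2) ^ s"
proof -
  have "lattice_term 0 y p = inverse_mean y / 2" "lattice_term 0 y (prod.swap p) = inverse_mean y / 2"
    if "p \<in> diagonal_vectors" for p
    using that assms(1) by (auto simp: diagonal_vectors_def lattice_term_axis inverse_mean_def divide_simps)
  hence "(\<Sum>p\<in>diagonal_vectors. lattice_term 0 y p ^ s + lattice_term 0 y (prod.swap p) ^ s)
      = (\<Sum>p\<in>diagonal_vectors. 2 * (inverse_mean y / 2) ^ s)"
    by (intro sum.cong refl) (simp only: mult_2)
  also have "\<dots> = 8 * (inverse_mean y / 2) ^ s"
    by (simp add: diagonal_vectors_def)
  finally have diagonal: "(\<Sum>p\<in>diagonal_vectors. lattice_term 0 y p ^ s + lattice_term 0 y (prod.swap p) ^ s)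
      = 8 * (inverse_mean y / 2) ^ s" .
  have "2 * lattice_sum s 0 y
        - (\<Sum>p\<in>diagonal_vectors. lattice_term 0 y p ^ s + lattice_term 0 y (prod.swap p) ^ s)
      \<le> power_pair s y * lattice_sum s 0 1 - (\<Sum>p\<in>diagonal_vectors. power_pair s y * lattice_term 0 1 p ^ s)"
    using assms by (intro has_sum_le_outside_finite[OF lattice_sum_swap_has_sum
      has_sum_cmult_right[OF lattice_term_has_sum] diagonal_vectors_subset_lattice] lattice_term_swap_le) auto
  moreover have "(\<Sum>p\<in>diagonal_vectors. power_pair s y * lattice_term 0 1 p ^ s)
      = 4 * power_pair s y * (1 / 2) ^ s"
    by (simp add: diagonal_vectors_def lattice_term_axis)
  ultimately show ?thesis unfolding diagonal by (simp add: algebra_simps)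
qed

lemma lattice_sum_axis_ge:
  assumes "y > 0" "s \<ge> 2"
  shows "2 * power_pair s y + inverse_mean y ^ s * (lattice_sum s 0 1 - 4) \<le> lattice_sum s 0 y"
proof -
  have "2 * inverse_mean y ^ s * lattice_sum s 0 1
        - (\<Sum>p\<in>unit_vectors. 2 * inverse_mean y ^ s * lattice_term 0 1 p ^ s)
      \<le> 2 * lattice_sum s 0 y
        - (\<Sum>p\<in>unit_vectors. lattice_term 0 y p ^ s + lattice_term 0 y (prod.swap p) ^ s)"
    using assms by (intro has_sum_le_outside_finite[OF has_sum_cmult_right[OF lattice_term_has_sum]
      lattice_sum_swap_has_sum unit_vectors_subset_lattice] lattice_term_swap_ge) auto
  moreover have "(\<Sum>p\<in>unit_vectors. 2 * inverse_mean y ^ s * lattice_term 0 1 p ^ s)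
      = 8 * inverse_mean y ^ s"
    by (simp add: unit_vectors_def lattice_term_axis)
  moreover have "(\<Sum>p\<in>unit_vectors. lattice_term 0 y p ^ s + lattice_term 0 y (prod.swap p) ^ s)
      = 4 * power_pair s y"
    using assms(1) by (simp add: unit_vectors_def lattice_term_axis power_pair_def)
  ultimately show ?thesis by (simp add: algebra_simps)
qed

lemma square_lattice_sum_minus_units_le:
  assumes "2 \<le> s" "s \<le> t"
  shows "lattice_sum t 0 1 - 4 \<le> (1 / 2) ^ (t - s) * (lattice_sum s 0 1 - 4)"
proof -
  have "lattice_term 0 1 p ^ t \<le> (1 / 2) ^ (t - s) * lattice_term 0 1 p ^ s"
      if p: "p \<in> lattice - unit_vectors" for p
  proof -
    obtain m n where mn: "p = (m, n)" by (cases p)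
    have "2 \<le> m\<^sup>2 + n\<^sup>2"
    proof (rule ccontr)
      assume "\<not> 2 \<le> m\<^sup>2 + n\<^sup>2"
      hence "m\<^sup>2 \<le> 1" "n\<^sup>2 \<le> 1" and norm: "m\<^sup>2 + n\<^sup>2 \<le> 1"
        using zero_le_power2[of m] zero_le_power2[of n] by linarith+
      hence "m \<in> {-1, 0, 1}" "n \<in> {-1, 0, 1}" by (auto simp: abs_square_le_1)
      thus False using norm p by (auto simp: mn lattice_def unit_vectors_def)
    qed
    hence "real_of_int 2 \<le> real_of_int (m\<^sup>2 + n\<^sup>2)" by (simp only: of_int_le_iff)
    hence "lattice_term 0 1 p \<le> 1 / 2" by (simp add: mn lattice_term_axis field_simps)
    hence "lattice_term 0 1 p ^ (t - s) * lattice_term 0 1 p ^ s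
        \<le> (1 / 2) ^ (t - s) * lattice_term 0 1 p ^ s"
      by (intro mult_right_mono power_mono) (auto intro!: zero_le_power lattice_term_nonneg)
    thus ?thesis using assms(2) by (simp flip: power_add)
  qed
  hence "lattice_sum t 0 1 - (\<Sum>p\<in>unit_vectors. lattice_term 0 1 p ^ t)
      \<le> (1 / 2) ^ (t - s) * lattice_sum s 0 1
        - (\<Sum>p\<in>unit_vectors. (1 / 2) ^ (t - s) * lattice_term 0 1 p ^ s)"
    using assms by (intro has_sum_le_outside_finite[OF lattice_term_has_sum
      has_sum_cmult_right[OF lattice_term_has_sum] unit_vectors_subset_lattice]) auto
  thus ?thesis by (simp add: unit_vectors_def lattice_term_axis algebra_simps)
qed

section \<open>The square lattice\<close>

definition int_square :: "nat \<Rightarrow> (int \<times> int) set" where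
  "int_square R = {- int R..int R} \<times> {- int R..int R}"

lemma finite_int_square: "finite (int_square R)"
  by (simp add: int_square_def)

lemma int_square_mono: "R \<le> R' \<Longrightarrow> int_square R \<subseteq> int_square R'"
  by (auto simp: int_square_def)

lemma finite_subset_int_square:
  assumes "finite F"
  obtains R where "R \<ge> k" "F \<subseteq> int_square R"
proof -
  define R where "R = k + (\<Sum>p\<in>F. nat \<bar>fst p\<bar> + nat \<bar>snd p\<bar>)"
  have "p \<in> int_square R" if "p \<in> F" for p
  proof -
    have "nat \<bar>fst p\<bar> + nat \<bar>snd p\<bar> \<le> (\<Sum>p\<in>F. nat \<bar>fst p\<bar> + nat \<bar>snd p\<bar>)"
      by (rule member_le_sum[OF that]) (use assms in auto)
    hence "\<bar>fst p\<bar> \<le> int R" "\<bar>snd p\<bar> \<le> int R" unfolding R_def by linarith+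
    thus ?thesis by (cases p) (auto simp: int_square_def)
  qed
  hence "F \<subseteq> int_square R" by blast
  thus thesis by (rule that[rotated]) (simp add: R_def)
qed

lemma card_int_square_shell: "card (int_square (Suc R) - int_square R) = 8 * Suc R"
proof -
  have "card (int_square (Suc R) - int_square R) = card (int_square (Suc R)) - card (int_square R)"
    by (rule card_Diff_subset[OF finite_int_square int_square_mono]) simp
  thus ?thesis by (simp add: int_square_def card_cartesian_product nat_add_distrib algebra_simps)
qed

lemma lattice_term_outside_int_square_le:
  assumes "p \<notin> int_square R"
  shows "lattice_term 0 1 p \<le> 1 / (real (Suc R))\<^sup>2"
proof -
  obtain m n where mn: "p = (m, n)" by (cases p)
  have "int (Suc R) \<le> \<bar>m\<bar> \<or> int (Suc R) \<le> \<bar>n\<bar>" using assms by (auto simp: int_square_def mn)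
  hence "(int (Suc R))\<^sup>2 \<le> m\<^sup>2 \<or> (int (Suc R))\<^sup>2 \<le> n\<^sup>2"
    by (metis of_nat_0_le_iff power2_abs power_mono)
  hence "(int (Suc R))\<^sup>2 \<le> m\<^sup>2 + n\<^sup>2"
    by (auto intro: add_increasing add_increasing2)
  hence "real_of_int ((int (Suc R))\<^sup>2) \<le> real_of_int (m\<^sup>2 + n\<^sup>2)" by (simp only: of_int_le_iff)
  thus ?thesis by (simp add: mn lattice_term_axis frac_le)
qed

lemma sum_int_square_Suc_le:
  "(\<Sum>p\<in>int_square (Suc R). lattice_term 0 1 p ^ s)
     \<le> (\<Sum>p\<in>int_square R. lattice_term 0 1 p ^ s) + 8 * real (Suc R) * (1 / (real (Suc R))\<^sup>2) ^ s"
proof -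
  have "(\<Sum>p\<in>int_square (Suc R) - int_square R. lattice_term 0 1 p ^ s)
      \<le> of_nat (card (int_square (Suc R) - int_square R)) * (1 / (real (Suc R))\<^sup>2) ^ s"
    by (intro sum_bounded_above power_mono lattice_term_outside_int_square_le lattice_term_nonneg) auto
  moreover have "(\<Sum>p\<in>int_square (Suc R). lattice_term 0 1 p ^ s)
      = (\<Sum>p\<in>int_square (Suc R) - int_square R. lattice_term 0 1 p ^ s)
          + (\<Sum>p\<in>int_square R. lattice_term 0 1 p ^ s)"
    by (intro sum.subset_diff finite_int_square int_square_mono) simp
  ultimately show ?thesis by (simp add: card_int_square_shell)
qed

lemma sum_cubes_int_square_le:
  assumes "R \<ge> 3"
  shows "(\<Sum>p\<in>int_square R. lattice_term 0 1 p ^ 3) \<le> 4.68 - 2 / (real R) ^ 4"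
  using assms
proof (induction R rule: dec_induct)
  case base
  have interval: "{- 3..3} = {- 3, - 2, - 1, 0, 1, 2, 3 :: int}" by auto
  have "(\<Sum>p\<in>int_square 3. lattice_term 0 1 p ^ 3) = (\<Sum>m\<in>{- 3..3}. \<Sum>n\<in>{- 3..3}. lattice_term 0 1 (m, n) ^ 3)"
    by (simp add: int_square_def sum.cartesian_product)
  also have "\<dots> \<le> 4.653" unfolding interval by (simp add: lattice_term_def power_divide)
  finally show ?case by simp
next
  case (step R)
  define t where "t = real R"
  have t: "t \<ge> 3" using step by (simp add: t_def)
  have "(t + 1) ^ 5 = 4 * t ^ 4 + t ^ 4 * (t + 1) + (10 * t ^ 3 + 10 * t ^ 2 + 5 * t + 1)" by algebra
  hence "4 * t ^ 4 + t ^ 4 * (t + 1) \<le> (t + 1) ^ 5" using t by simp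
  hence "8 / (t + 1) ^ 5 \<le> 2 / t ^ 4 - 2 / (t + 1) ^ 4"
    using t by (simp add: divide_simps) (simp add: algebra_simps eval_nat_numeral)
  moreover have "8 * u * (1 / u\<^sup>2) ^ 3 = 8 / u ^ 5" if "u > 0" for u :: real
    using that by (simp add: power_divide field_simps eval_nat_numeral)
  from this[of "t + 1"] have "(\<Sum>p\<in>int_square (Suc R). lattice_term 0 1 p ^ 3)
      \<le> (\<Sum>p\<in>int_square R. lattice_term 0 1 p ^ 3) + 8 / (t + 1) ^ 5"
    using sum_int_square_Suc_le[of 3 R] t by (simp add: t_def add.commute)
  ultimately show ?case using step.IH by (simp add: t_def add.commute)
qed

lemma square_lattice_sum_3_le: "lattice_sum 3 0 1 \<le> 4.68"
  unfolding lattice_sum_def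
proof (rule infsum_le_finite_sums)
  show "(\<lambda>p. lattice_term 0 1 p ^ 3) summable_on lattice" by (rule summable_lattice_term) auto
  fix F assume "finite F" "F \<subseteq> lattice"
  then obtain R where R: "R \<ge> 3" "F \<subseteq> int_square R" using finite_subset_int_square by blast
  hence "(\<Sum>p\<in>F. lattice_term 0 1 p ^ 3) \<le> (\<Sum>p\<in>int_square R. lattice_term 0 1 p ^ 3)"
    by (intro sum_mono2 finite_int_square) (auto intro!: zero_le_power lattice_term_nonneg)
  also have "\<dots> \<le> 4.68 - 2 / (real R) ^ 4" by (rule sum_cubes_int_square_le[OF R(1)])
  finally show "(\<Sum>p\<in>F. lattice_term 0 1 p ^ 3) \<le> 4.68" by (rule order_trans) simp
qed

section \<open>Reduction to the fundamental domain\<close>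

text \<open>This relation leaves every lattice sum invariant, and also the discrete set of values of
  \<open>lattice_term x y\<close>, which contains the height \<open>y\<close>; so an equivalent point of maximal height
  exists, without any reference to the modular group.\<close>

definition lattice_equiv :: "real \<Rightarrow> real \<Rightarrow> real \<Rightarrow> real \<Rightarrow> bool" where
  "lattice_equiv x y x' y' \<longleftrightarrow>
     (\<exists>h. bij_betw h lattice lattice \<and> (\<forall>p\<in>lattice. lattice_term x' y' p = lattice_term x y (h p)))"

lemma lattice_equiv_refl: "lattice_equiv x y x y"
  unfolding lattice_equiv_def by (intro exI[of _ id]) auto

lemma lattice_equiv_trans:
  assumes "lattice_equiv x y x' y'" "lattice_equiv x' y' x'' y''"
  shows "lattice_equiv x y x'' y''"
proof -
  obtain h where h: "bij_betw h lattice lattice"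
      "\<And>p. p \<in> lattice \<Longrightarrow> lattice_term x' y' p = lattice_term x y (h p)"
    using assms(1) by (auto simp: lattice_equiv_def)
  obtain k where k: "bij_betw k lattice lattice"
      "\<And>p. p \<in> lattice \<Longrightarrow> lattice_term x'' y'' p = lattice_term x' y' (k p)"
    using assms(2) by (auto simp: lattice_equiv_def)
  have "lattice_term x'' y'' p = lattice_term x y ((h \<circ> k) p)" if "p \<in> lattice" for p
    using h(2) k(2)[OF that] bij_betwE[OF k(1)] that by simp
  thus ?thesis unfolding lattice_equiv_def using bij_betw_trans[OF k(1) h(1)] by blast
qed

lemma lattice_equiv_translate: "lattice_equiv x y (x + of_int k) y"
proof -
  have "bij_betw (\<lambda>(m, n). (m, n + k * m)) lattice lattice"
    by (rule bij_betw_byWitness[where f' = "\<lambda>(m, n). (m, n - k * m)"]) (auto simp: lattice_def)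
  moreover have "lattice_term (x + of_int k) y p = lattice_term x y ((\<lambda>(m, n). (m, n + k * m)) p)" for p
    by (cases p) (simp add: lattice_term_def algebra_simps)
  ultimately show ?thesis unfolding lattice_equiv_def by blast
qed

lemma lattice_equiv_reflect: "lattice_equiv x y (- x) y"
proof -
  have "bij_betw (\<lambda>(m, n). (- m, n)) lattice lattice"
    by (rule bij_betw_byWitness[where f' = "\<lambda>(m, n). (- m, n)"]) (auto simp: lattice_def)
  moreover have "lattice_term (- x) y p = lattice_term x y ((\<lambda>(m, n). (- m, n)) p)" for p
    by (cases p) (simp add: lattice_term_def)
  ultimately show ?thesis unfolding lattice_equiv_def by blast
qed

lemma lattice_equiv_invert:
  assumes "y > 0"
  shows "lattice_equiv x y (- x / (x\<^sup>2 + y\<^sup>2)) (y / (x\<^sup>2 + y\<^sup>2))"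
proof -
  define D where "D = x\<^sup>2 + y\<^sup>2"
  have D: "D > 0" using assms by (simp add: D_def add_nonneg_pos)
  have "bij_betw (\<lambda>(m, n). (n, - m)) lattice lattice"
    by (rule bij_betw_byWitness[where f' = "\<lambda>(m, n). (- n, m)"]) (auto simp: lattice_def)
  moreover have "lattice_term (- x / D) (y / D) p = lattice_term x y ((\<lambda>(m, n). (n, - m)) p)" for p
  proof -
    obtain m n where mn: "p = (m, n)" by (cases p)
    have "D * ((m * (- x / D) + n)\<^sup>2 + (m * (y / D))\<^sup>2) = ((n * D - m * x)\<^sup>2 + (m * y)\<^sup>2) / D"
      using D by (simp add: field_simps power2_eq_square)
    also have "(n * D - m * x)\<^sup>2 + (m * y)\<^sup>2 = D * ((n * x + - m)\<^sup>2 + (n * y)\<^sup>2)"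
      unfolding D_def of_int_minus by algebra
    finally have "D * ((m * (- x / D) + n)\<^sup>2 + (m * (y / D))\<^sup>2) = (n * x + - m)\<^sup>2 + (n * y)\<^sup>2"
      using D by simp
    moreover have "y / D / Q = y / (D * Q)" for Q by simp
    ultimately show ?thesis by (simp add: mn lattice_term_def)
  qed
  ultimately show ?thesis unfolding lattice_equiv_def D_def by blast
qed

lemma lattice_equiv_lattice_sum:
  assumes "lattice_equiv x y x' y'"
  shows "lattice_sum s x' y' = lattice_sum s x y"
proof -
  obtain h where h: "bij_betw h lattice lattice"
      "\<And>p. p \<in> lattice \<Longrightarrow> lattice_term x' y' p = lattice_term x y (h p)"
    using assms by (auto simp: lattice_equiv_def)
  have "lattice_sum s x' y' = infsum (\<lambda>p. lattice_term x y (h p) ^ s) lattice"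
    unfolding lattice_sum_def by (rule infsum_cong) (simp add: h)
  also have "\<dots> = lattice_sum s x y"
    unfolding lattice_sum_def by (rule infsum_reindex_bij_betw[OF h(1)])
  finally show ?thesis .
qed

lemma lattice_equiv_height:
  assumes "lattice_equiv x y x' y'"
  obtains p where "p \<in> lattice" "y' = lattice_term x y p"
proof -
  obtain h where h: "bij_betw h lattice lattice"
      "\<And>p. p \<in> lattice \<Longrightarrow> lattice_term x' y' p = lattice_term x y (h p)"
    using assms by (auto simp: lattice_equiv_def)
  have "(0, 1) \<in> lattice" by (simp add: lattice_def)
  moreover from this have "h (0, 1) \<in> lattice" using bij_betwE[OF h(1)] by blast
  ultimately show thesis using that h(2)[of "(0, 1)"] by (simp add: lattice_term_def)
qed

lemma finite_large_lattice_terms: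
  assumes "y > 0" "c > 0"
  shows "finite {p. c \<le> lattice_term x y p}"
proof -
  obtain C where C: "\<And>p. lattice_term x y p \<le> C * lattice_term 0 1 p"
    using lattice_term_le_square_lattice_term[OF assms(1), of y x] by (metis atLeastAtMost_iff order.refl)
  have "p \<in> int_square (nat \<lceil>C / c\<rceil>)" if "c \<le> lattice_term x y p" for p
  proof (rule ccontr)
    define R where "R = nat \<lceil>C / c\<rceil>"
    assume "p \<notin> int_square (nat \<lceil>C / c\<rceil>)"
    hence outside: "lattice_term 0 1 p \<le> 1 / (real (Suc R))\<^sup>2"
      unfolding R_def by (rule lattice_term_outside_int_square_le)
    have "0 < C * lattice_term 0 1 p" using that C[of p] assms(2) by linarith
    hence C_pos: "C > 0" using lattice_term_nonneg[of 1 0 p] by (auto simp: zero_less_mult_iff)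
    have "c \<le> C * (1 / (real (Suc R))\<^sup>2)"
      using that C[of p] mult_left_mono[OF outside, of C] C_pos by linarith
    hence "(real (Suc R))\<^sup>2 \<le> C / c" using assms(2) by (simp add: field_simps)
    moreover have "C / c \<le> real R" unfolding R_def by linarith
    moreover have "real R < (real (Suc R))\<^sup>2" by (simp add: power2_eq_square algebra_simps add_pos_nonneg)
    ultimately show False by linarith
  qed
  hence "{p. c \<le> lattice_term x y p} \<subseteq> int_square (nat \<lceil>C / c\<rceil>)" by blast
  thus ?thesis by (rule finite_subset) (rule finite_int_square)
qed

lemma lattice_equiv_maximal_height:
  assumes "y > 0"
  obtains X Y where "lattice_equiv x y X Y" "y \<le> Y" "\<And>x' y'. lattice_equiv x y x' y' \<Longrightarrow> y' \<le> Y"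
proof -
  define A where "A = {y'. y \<le> y' \<and> (\<exists>x'. lattice_equiv x y x' y')}"
  have "A \<subseteq> lattice_term x y ` {p. y \<le> lattice_term x y p}"
    by (auto simp: A_def elim!: lattice_equiv_height)
  hence finite: "finite A" using finite_large_lattice_terms[OF assms assms]
    by (meson finite_imageI finite_subset)
  have "y \<in> A" using lattice_equiv_refl by (auto simp: A_def)
  hence "Max A \<in> A" using finite by (intro Max_in) auto
  then obtain X where X: "lattice_equiv x y X (Max A)" "y \<le> Max A" by (auto simp: A_def)
  moreover have "y' \<le> Max A" if "lattice_equiv x y x' y'" for x' y'
  proof (cases "y \<le> y'")
    case True
    thus ?thesis using that finite by (intro Max_ge) (auto simp: A_def)
  next
    case False
    thus ?thesis using X(2) by simp
  qed
  ultimately show thesis using that by blast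
qed

lemma lattice_reduction:
  assumes "y > 0"
  obtains x' y' where "y' > 0" "lattice_equiv x y x' y'" "0 \<le> x'" "x' \<le> 1 / 2" "1 \<le> x'\<^sup>2 + y'\<^sup>2"
proof -
  obtain X Y where XY: "lattice_equiv x y X Y" "y \<le> Y"
    and maximal: "\<And>x' y'. lattice_equiv x y x' y' \<Longrightarrow> y' \<le> Y"
    using lattice_equiv_maximal_height[OF assms] by blast
  have Y: "Y > 0" using XY assms by simp
  define u where "u = X + of_int (- round X)"
  have u: "\<bar>u\<bar> \<le> 1 / 2"
    using of_int_round_abs_le[of X] by (simp add: u_def abs_minus_commute)
  have equiv: "lattice_equiv x y u Y"
    unfolding u_def by (rule lattice_equiv_trans[OF XY(1) lattice_equiv_translate])
  have norm: "1 \<le> u\<^sup>2 + Y\<^sup>2"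
  proof (rule ccontr)
    assume "\<not> 1 \<le> u\<^sup>2 + Y\<^sup>2"
    moreover have "0 < u\<^sup>2 + Y\<^sup>2" using Y by (simp add: add_nonneg_pos)
    ultimately have "Y < Y / (u\<^sup>2 + Y\<^sup>2)"
      using Y mult_strict_left_mono[of "u\<^sup>2 + Y\<^sup>2" 1 Y] by (simp add: pos_less_divide_eq)
    thus False
      using maximal[OF lattice_equiv_trans[OF equiv lattice_equiv_invert[OF Y]]] by simp
  qed
  show thesis
  proof (cases "u \<ge> 0")
    case True
    thus ?thesis using that[OF Y equiv] u norm by simp
  next
    case False
    thus ?thesis using that[OF Y lattice_equiv_trans[OF equiv lattice_equiv_reflect]] u norm by simp
  qed
qed

section \<open>Comparison with the imaginary axis\<close>

lemma epstein_zeta_eq_lattice_energy: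
  "Im z > 0 \<Longrightarrow> epstein_zeta 6 z - b * epstein_zeta 3 z = lattice_energy b (Re z) (Im z)"
  using epstein_zeta_eq_lattice_sum[of z 6] epstein_zeta_eq_lattice_sum[of z 3]
  by (simp add: lattice_energy_def)

lemma lattice_energy_ge_axis:
  assumes "y \<ge> 1" "b \<ge> 3"
  shows "lattice_energy b 0 y \<le> lattice_energy b x y"
proof -
  have "3 * (lattice_sum 3 0 y - lattice_sum 3 x y) \<le> b * (lattice_sum 3 0 y - lattice_sum 3 x y)"
    using assms lattice_sum_le_axis[of y 3 x] by (intro mult_right_mono) auto
  thus ?thesis
    using lattice_sum_diff_6_le_3[OF assms(1), of x] by (simp add: lattice_energy_def algebra_simps)
qed

lemma power_pair_3_near_1_ge:
  fixes y :: real
  assumes "0.866 \<le> y" "y \<le> 1"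
  defines "d \<equiv> 1 - y"
  shows "d\<^sup>2 * (9 + 9 * d + 15 * d ^ 2 + 21 * d ^ 3) \<le> power_pair 3 y - 2"
proof -
  define v where "v = 1 / y"
  have d: "0 \<le> d" "d \<le> 0.134" and v: "v * (1 - d) = 1" using assms by (auto simp: d_def v_def)
  have v_ge_1: "1 \<le> v" using inverse_one_minus_bounds[OF v d] by simp
  have "(3 - 3 * d + d ^ 2) ^ 2 * v ^ 3 - (9 + 9 * d + 15 * d ^ 2 + 21 * d ^ 3)
      = v ^ 3 * (d ^ 4 * (28 - 48 * d + 21 * d ^ 2))"
    using v by algebra
  also have "\<dots> \<ge> 0" using v_ge_1 d by (intro mult_nonneg_nonneg) auto
  finally have "d\<^sup>2 * (9 + 9 * d + 15 * d ^ 2 + 21 * d ^ 3) \<le> d\<^sup>2 * ((3 - 3 * d + d ^ 2) ^ 2 * v ^ 3)"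
    by (intro mult_left_mono) auto
  also have "\<dots> = (1 - d) ^ 3 + v ^ 3 - 2" using v by algebra
  also have "\<dots> = power_pair 3 y - 2" by (simp add: power_pair_def v_def d_def)
  finally show ?thesis .
qed

lemma power_pair_3_near_1_le:
  fixes y :: real
  assumes "0.866 \<le> y" "y \<le> 1"
  shows "power_pair 3 y - 2 \<le> 11 * (1 - y)\<^sup>2"
proof -
  define d where "d = 1 - y"
  define v where "v = 1 / y"
  have d: "0 \<le> d" "d \<le> 0.134" and v: "v * (1 - d) = 1" using assms by (auto simp: d_def v_def)
  note v_bounds = inverse_one_minus_bounds[OF v d]
  have "power_pair 3 y - 2 = (1 - d) ^ 3 + v ^ 3 - 2" by (simp add: power_pair_def v_def d_def)
  also have "\<dots> = (3 + d\<^sup>2 * v)\<^sup>2 * v * d\<^sup>2" using v by algebra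
  also have "\<dots> \<le> (3 + 0.134\<^sup>2 * 1.1548)\<^sup>2 * 1.1548 * d\<^sup>2"
    using d v_bounds by (intro mult_mono power_mono add_mono) auto
  also have "\<dots> \<le> 11 * d\<^sup>2" by (intro mult_right_mono) (simp_all add: power2_eq_square)
  finally show ?thesis by (simp add: d_def)
qed

lemma inverse_mean_near_1_le:
  fixes y :: real
  assumes "0.866 \<le> y" "y \<le> 1"
  defines "d \<equiv> 1 - y" and "q \<equiv> inverse_mean y"
  shows "1.99 * (d\<^sup>2 * (1 + d + d ^ 2)) \<le> 1.531 * (1 - q ^ 3) - 0.085 * (1 - q ^ 6)"
proof -
  define v where "v = 1 / y"
  define t where "t = d\<^sup>2 * v / 2"
  have d: "0 \<le> d" "d \<le> 0.134" and v: "v * (1 - d) = 1" using assms by (auto simp: d_def v_def)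
  note v_bounds = inverse_one_minus_bounds[OF v d]
  have "d\<^sup>2 * v / 2 \<le> 0.134\<^sup>2 * 1.1548 / 2"
    using d v_bounds by (intro divide_right_mono mult_mono power_mono) auto
  hence t: "0 \<le> t" "t \<le> 0.011" using v_bounds by (auto simp: t_def power2_eq_square)
  have "(1 - d) + v = 2 * (1 + t)" unfolding t_def using v by algebra
  hence "y + 1 / y = 2 * (1 + t)" by (simp add: d_def v_def)
  hence qt: "q * (1 + t) = 1" using t(1) by (simp add: q_def inverse_mean_def)
  have q: "0 \<le> q" "q \<le> 1" using inverse_mean_bounds[of y] assms by (auto simp: q_def)
  have "1 - 3 * t + 6 * t ^ 2 - q ^ 3 = q ^ 3 * (10 * t ^ 3 + 15 * t ^ 4 + 6 * t ^ 5)"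
    using qt by algebra
  also have "\<dots> \<ge> 0" using q t by (intro mult_nonneg_nonneg) auto
  finally have "3 * t - 6 * (t * t) \<le> 1 - q ^ 3" by (simp add: power2_eq_square)
  moreover have "t * t \<le> 0.011 * t" using t by (intro mult_right_mono) auto
  ultimately have cube: "2.93 * t \<le> 1 - q ^ 3" using t(1) by simp
  have "d\<^sup>2 * (1 + d + d ^ 2) \<le> 2 * t"
    using mult_left_mono[OF inverse_one_minus_power_ge(1)[OF v d], of "d\<^sup>2"] by (simp add: t_def)
  hence "1.99 * (d\<^sup>2 * (1 + d + d ^ 2)) \<le> 2.93 * t * 1.361" using t(1) by simp
  also have "\<dots> \<le> (1 - q ^ 3) * (1.531 - 0.085 * (1 + q ^ 3))"
    using cube q t(1) power_le_one[of q 3] by (intro mult_mono) auto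
  also have "\<dots> = 1.531 * (1 - q ^ 3) - 0.085 * (1 - q ^ 6)" by algebra
  finally show ?thesis .
qed

lemma descent_margin_le_axis_gain:
  fixes y :: real
  assumes "0.866 \<le> y" "y \<le> 1"
  defines "d \<equiv> 1 - y" and "p \<equiv> power_pair 3 y" and "q \<equiv> inverse_mean y"
  shows "d\<^sup>2 * descent_margin d
     \<le> 2 * (p\<^sup>2 - 4) - 0.085 * (1 - q ^ 6) - 3.062 * (4.18 * (p / 2 - 1) - 1 / 2 * (1 - q ^ 3))"
proof -
  define g where "g = 9 + 9 * d + 15 * d ^ 2 + 21 * d ^ 3"
  have d: "0 \<le> d" using assms by (simp add: d_def)
  have powers: "0 \<le> d ^ 2" "0 \<le> d ^ 3" "0 \<le> d ^ 4" "0 \<le> d ^ 5" "0 \<le> d ^ 6" using d by auto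
  have p: "d\<^sup>2 * g \<le> p - 2"
    unfolding d_def p_def g_def by (rule power_pair_3_near_1_ge[OF assms(1,2)])
  have g_nonneg: "0 \<le> g" using d powers by (simp add: g_def)
  have "g\<^sup>2 = 81 + 162 * d + 351 * d ^ 2 + (648 * d ^ 3 + 603 * d ^ 4 + 630 * d ^ 5 + 441 * d ^ 6)"
    unfolding g_def by algebra
  hence g_square: "81 + 162 * d + 351 * d ^ 2 \<le> g\<^sup>2" using powers by simp
  have quartic: "2 * d\<^sup>2 * (81 + 162 * d + 351 * d ^ 2)
      = 162 * d ^ 2 + 324 * d ^ 3 + 702 * d ^ 4" by algebra
  have "descent_margin d \<le> 1.60042 * g + 2 * d\<^sup>2 * (81 + 162 * d + 351 * d ^ 2) + 1.99 * (1 + d + d ^ 2)"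
    unfolding descent_margin_def g_def quartic by (simp add: ring_distribs, use d powers in linarith)
  also have "\<dots> \<le> 1.60042 * g + 2 * d\<^sup>2 * g\<^sup>2 + 1.99 * (1 + d + d ^ 2)"
    using g_square by (intro add_mono mult_left_mono order.refl) auto
  finally have "d\<^sup>2 * descent_margin d \<le> d\<^sup>2 * (1.60042 * g + 2 * d\<^sup>2 * g\<^sup>2 + 1.99 * (1 + d + d ^ 2))"
    by (intro mult_left_mono) auto
  also have "\<dots> = 1.60042 * (d\<^sup>2 * g) + 2 * (d\<^sup>2 * g)\<^sup>2 + 1.99 * (d\<^sup>2 * (1 + d + d ^ 2))" by algebra
  also have "\<dots> \<le> 1.60042 * (p - 2) + 2 * (p - 2)\<^sup>2 + (1.531 * (1 - q ^ 3) - 0.085 * (1 - q ^ 6))"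
    unfolding q_def d_def using p g_nonneg d
    by (intro add_mono mult_left_mono power_mono inverse_mean_near_1_le assms(1,2)) (auto simp: d_def)
  also have "\<dots> = 2 * (p\<^sup>2 - 4) - 0.085 * (1 - q ^ 6) - 3.062 * (4.18 * (p / 2 - 1) - 1 / 2 * (1 - q ^ 3))"
    by algebra
  finally show ?thesis .
qed

lemma axis_energy_gain:
  fixes y :: real
  assumes "0.866 \<le> y" "y \<le> 1"
  shows "(1 - y)\<^sup>2 * descent_margin (1 - y) \<le> lattice_energy 3.062 0 y - lattice_energy 3.062 0 1"
proof -
  define p where "p = power_pair 3 y"
  define q where "q = inverse_mean y"
  have y: "y > 0" using assms by simp
  have q: "0 \<le> q" "q \<le> 1" using inverse_mean_bounds[OF y] by (simp_all add: q_def)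
  have "lattice_sum 6 0 1 - 4 \<le> 0.085"
    using square_lattice_sum_minus_units_le[of 3 6] square_lattice_sum_3_le by (simp add: power_divide)
  hence "(1 - q ^ 6) * (lattice_sum 6 0 1 - 4) \<le> (1 - q ^ 6) * 0.085"
    using q by (intro mult_left_mono) (auto simp: power_le_one)
  moreover have "power_pair 6 y = p\<^sup>2 - 2"
    using power_pair_double[of y 3] y by (simp add: p_def)
  ultimately have gain_6: "2 * (p\<^sup>2 - 4) - 0.085 * (1 - q ^ 6) \<le> lattice_sum 6 0 y - lattice_sum 6 0 1"
    using lattice_sum_axis_ge[OF y, of 6]
    by (simp add: q_def[symmetric] left_diff_distrib right_diff_distrib)
  have "lattice_sum 3 0 y - lattice_sum 3 0 1
      \<le> (p / 2 - 1) * (lattice_sum 3 0 1 - 1 / 2) - 1 / 2 * (1 - q ^ 3)"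
    using lattice_sum_axis_le[OF y, of 3] by (simp add: p_def q_def power_divide algebra_simps)
  also have "(p / 2 - 1) * (lattice_sum 3 0 1 - 1 / 2) \<le> (p / 2 - 1) * 4.18"
    using power_pair_ge_2[OF y, of 3] square_lattice_sum_3_le by (intro mult_left_mono) (auto simp: p_def)
  finally have loss_3: "lattice_sum 3 0 y - lattice_sum 3 0 1 \<le> 4.18 * (p / 2 - 1) - 1 / 2 * (1 - q ^ 3)"
    by (simp add: mult.commute)
  have "(1 - y)\<^sup>2 * descent_margin (1 - y)
      \<le> 2 * (p\<^sup>2 - 4) - 0.085 * (1 - q ^ 6) - 3.062 * (4.18 * (p / 2 - 1) - 1 / 2 * (1 - q ^ 3))"
    unfolding p_def q_def by (rule descent_margin_le_axis_gain[OF assms])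
  also have "\<dots> \<le> (lattice_sum 6 0 y - lattice_sum 6 0 1) - 3.062 * (lattice_sum 3 0 y - lattice_sum 3 0 1)"
    by (rule diff_mono[OF gain_6 mult_left_mono[OF loss_3]]) simp
  also have "\<dots> = lattice_energy 3.062 0 y - lattice_energy 3.062 0 1"
    by (simp add: lattice_energy_def right_diff_distrib)
  finally show ?thesis .
qed

lemma sin_ge_chord:
  assumes "0 \<le> t" "t \<le> pi / 2"
  shows "2 * t / pi \<le> sin t"
proof -
  have "concave_on {0..pi} sin"
  proof (rule f''_le0_imp_concave)
    show "(sin has_field_derivative cos u) (at u)" "(cos has_field_derivative - sin u) (at u)" for u :: real
      by (auto intro!: derivative_eq_intros)
  qed (auto intro: sin_ge_zero)
  from concave_onD[OF this, of "2 * t / pi" 0 "pi / 2"] show ?thesis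
    using assms by simp
qed

lemma one_minus_cos_ge:
  assumes "\<bar>x\<bar> \<le> 1 / 2"
  shows "8 * x\<^sup>2 \<le> 1 - cos (2 * pi * x)"
proof -
  have "2 * \<bar>x\<bar> \<le> sin (pi * \<bar>x\<bar>)"
    using sin_ge_chord[of "pi * \<bar>x\<bar>"] assms by simp
  hence "(2 * \<bar>x\<bar>)\<^sup>2 \<le> (sin (pi * \<bar>x\<bar>))\<^sup>2" by (intro power_mono) auto
  moreover have "(sin (pi * \<bar>x\<bar>))\<^sup>2 = (sin (pi * x))\<^sup>2" by (cases "x \<ge> 0") auto
  ultimately show ?thesis by (simp add: one_minus_cos_eq power_mult_distrib mult.assoc)
qed

lemma fourier_coeff_3_ge:
  assumes "1 \<le> v"
  shows "48 \<le> fourier_coeff 3 v 1"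
proof -
  have "48 \<le> fourier_coeff 3 1 1" using pi_power_bounds by (simp add: fourier_coeff_3)
  also have "\<dots> \<le> fourier_coeff 3 v 1" using assms by (intro fourier_coeff_mono) auto
  finally show ?thesis .
qed

lemma row_drop_3_near_1_ge:
  fixes x y :: real
  assumes "0.866 \<le> y" "y \<le> 1" "\<bar>x\<bar> \<le> 1 / 2" "1 \<le> x\<^sup>2 + y\<^sup>2"
  defines "d \<equiv> 1 - y"
  shows "13 * d\<^sup>2 \<le> row_drop 3 x y"
proof -
  define E where "E = exp (- 2 * pi * y)"
  define r where "r = 1 - cos (2 * pi * x)"
  have y: "y > 0" and d: "0 \<le> d" "d \<le> 0.134" using assms by (auto simp: d_def)
  have "d * 1.866 \<le> (1 - y) * (1 + y)"
    using assms d by (intro mult_mono) (auto simp: d_def)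
  also have "\<dots> \<le> x\<^sup>2" using assms by (simp add: power2_eq_square algebra_simps)
  finally have x: "d * 1.866 \<le> x\<^sup>2" .
  have r: "8 * (d * 1.866) \<le> r" "0 \<le> r" "r \<le> 2"
    using one_minus_cos_ge[OF assms(3)] x cos_ge_minus_one[of "2 * pi * x"] by (auto simp: r_def)
  have E: "0.0018 * (1 + 6.28 * d) \<le> E"
    unfolding E_def using exp_minus_2pi_ge_linear[OF d(1)] by (simp add: d_def)
  have "13 * d \<le> 48 * (0.0018 * (1 + 6.28 * d)) * (8 * 1.866)" using d by simp
  from mult_right_mono[OF this d(1)]
  have "13 * d\<^sup>2 \<le> 48 * (0.0018 * (1 + 6.28 * d)) * (8 * (d * 1.866))"
    by (simp only: power2_eq_square mult_ac)
  also have "\<dots> \<le> fourier_coeff 3 (1 / y) 1 * E * r"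
    using E r d fourier_coeff_3_ge[of "1 / y"] assms(2) y by (intro mult_mono) (auto simp: E_def)
  also have "\<dots> \<le> fourier_coeff 3 (1 / y) 1 * E * r + fourier_coeff 3 (1 / y) 2 * E ^ 2 * (r * (4 - 2 * r))"
    using r y by (intro add_increasing2 order.refl mult_nonneg_nonneg fourier_coeff_nonneg) auto
  also have "\<dots> \<le> row_drop 3 x y"
    unfolding r_def E_def using y by (intro row_drop_lower_bound) auto
  finally show ?thesis .
qed

lemma lattice_sum_3_le_square:
  fixes x y :: real
  assumes "0.866 \<le> y" "y \<le> 1" "\<bar>x\<bar> \<le> 1 / 2" "1 \<le> x\<^sup>2 + y\<^sup>2"
  shows "lattice_sum 3 x y \<le> lattice_sum 3 0 1"
proof -
  have y: "y > 0" using assms by simp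
  have pair: "2 \<le> power_pair 3 y" by (rule power_pair_ge_2[OF y])
  have "inverse_mean y ^ 3 \<le> 1"
    using inverse_mean_bounds[OF y] by (intro power_le_one) auto
  hence "lattice_sum 3 0 y - lattice_sum 3 0 1 \<le> (power_pair 3 y - 2) / 2 * lattice_sum 3 0 1"
    using lattice_sum_axis_le[OF y, of 3] pair by (simp add: power_divide algebra_simps)
  also have "\<dots> \<le> (power_pair 3 y - 2) / 2 * 4.68"
    using pair square_lattice_sum_3_le by (intro mult_left_mono) auto
  also have "\<dots> \<le> (11 * (1 - y)\<^sup>2) / 2 * 4.68"
    using power_pair_3_near_1_le[OF assms(1,2)] by (intro mult_right_mono divide_right_mono) auto
  also have "\<dots> \<le> 2 * (13 * (1 - y)\<^sup>2)" by simp
  also have "\<dots> \<le> 2 * row_drop 3 x y"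
    using row_drop_3_near_1_ge[OF assms] by simp
  also have "\<dots> \<le> lattice_sum 3 0 y - lattice_sum 3 x y"
    using y by (intro lattice_sum_diff_ge_row_drop) auto
  finally show ?thesis by simp
qed

lemma lattice_energy_ge_square:
  assumes "0.866 \<le> y" "y \<le> 1" "\<bar>x\<bar> \<le> 1 / 2" "1 \<le> x\<^sup>2 + y\<^sup>2" "b \<ge> 3.062"
  shows "lattice_energy b 0 1 \<le> lattice_energy b x y"
proof -
  have "lattice_energy 3.062 0 1 \<le> lattice_energy 3.062 x y"
    using lattice_energy_diff_near_1_le[OF assms(1,2), of x] axis_energy_gain[OF assms(1,2)] by linarith
  moreover have "(b - 3.062) * lattice_sum 3 x y \<le> (b - 3.062) * lattice_sum 3 0 1"
    using assms(5) by (intro mult_left_mono lattice_sum_3_le_square assms(1-4)) auto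
  ultimately show ?thesis by (simp add: lattice_energy_def algebra_simps)
qed

section \<open>Minimization\<close>

lemma lattice_sum_axis_ge_power:
  assumes "y > 0" "s \<ge> 2"
  shows "2 * y ^ s \<le> lattice_sum s 0 y"
proof -
  have "(\<Sum>p\<in>{(0, 1), (0, - 1)}. lattice_term 0 y p ^ s) \<le> lattice_sum s 0 y"
    using assms by (intro finite_sum_le_has_sum[OF lattice_term_has_sum] zero_le_power lattice_term_nonneg)
      (auto simp: lattice_def)
  thus ?thesis using assms(1) by (simp add: lattice_term_def power2_eq_square)
qed

lemma lattice_sum_axis_le_power:
  assumes "y \<ge> 1" "s \<ge> 2"
  shows "lattice_sum s 0 y \<le> y ^ s * lattice_sum s 0 1"
proof (rule has_sum_mono)
  show "((\<lambda>p. lattice_term 0 y p ^ s) has_sum lattice_sum s 0 y) lattice"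
    using assms by (intro lattice_term_has_sum) auto
  show "((\<lambda>p. y ^ s * lattice_term 0 1 p ^ s) has_sum y ^ s * lattice_sum s 0 1) lattice"
    using assms by (intro has_sum_cmult_right lattice_term_has_sum) auto
  fix p assume p: "p \<in> lattice"
  obtain m n where mn: "p = (m, n)" by (cases p)
  have "1 \<le> (real_of_int m)\<^sup>2 + (real_of_int n)\<^sup>2" using p lattice_norm_ge_1 mn by simp
  moreover have "(real_of_int m)\<^sup>2 * 1 \<le> (real_of_int m)\<^sup>2 * y\<^sup>2"
    using assms(1) by (intro mult_left_mono one_le_power) auto
  ultimately have "lattice_term 0 y p \<le> y * lattice_term 0 1 p"
    using assms(1) by (simp add: mn lattice_term_def power_mult_distrib frac_le)
  thus "lattice_term 0 y p ^ s \<le> y ^ s * lattice_term 0 1 p ^ s"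
    unfolding power_mult_distrib[symmetric] using assms(1) by (intro power_mono lattice_term_nonneg) auto
qed

lemma lattice_energy_axis_coercive:
  assumes "b \<ge> 0"
  obtains Y where "Y \<ge> 1" "\<And>y. y \<ge> Y \<Longrightarrow> c \<le> lattice_energy b 0 y"
proof -
  define S where "S = lattice_sum 3 0 1"
  have S: "S \<ge> 0" using lattice_sum_axis_ge_power[of 1 3] by (simp add: S_def)
  define Y where "Y = 1 + b * S + \<bar>c\<bar>"
  have Y: "Y \<ge> 1" using S assms by (simp add: Y_def)
  have "c \<le> lattice_energy b 0 y" if y: "y \<ge> Y" for y
  proof -
    have y_ge_1: "y \<ge> 1" using y Y by simp
    hence cube: "y \<le> y ^ 3" "1 \<le> y ^ 3" by (simp_all add: self_le_power)
    have "1 * \<bar>c\<bar> \<le> y ^ 3 * (2 * y ^ 3 - b * S)"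
      using cube y y_ge_1 by (intro mult_mono) (auto simp: Y_def)
    also have "\<dots> = 2 * y ^ 6 - b * (y ^ 3 * S)" by algebra
    also have "\<dots> \<le> lattice_energy b 0 y"
      unfolding lattice_energy_def S_def using y_ge_1 assms
      by (intro diff_mono mult_left_mono lattice_sum_axis_ge_power lattice_sum_axis_le_power) auto
    finally show ?thesis by simp
  qed
  thus thesis using that Y by blast
qed

lemma lattice_energy_attains_axis_minimum:
  assumes "b \<ge> 0"
  obtains y0 where "y0 \<ge> 1" "\<And>y. y \<ge> 1 \<Longrightarrow> lattice_energy b 0 y0 \<le> lattice_energy b 0 y"
proof -
  obtain Y where Y: "Y \<ge> 1" "\<And>y. y \<ge> Y \<Longrightarrow> lattice_energy b 0 1 \<le> lattice_energy b 0 y"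
    using lattice_energy_axis_coercive[OF assms] by blast
  have "continuous_on {0<..} (lattice_energy b 0)"
    unfolding lattice_energy_def[abs_def] by (intro continuous_intros continuous_on_lattice_sum) auto
  hence "continuous_on {1..Y} (lattice_energy b 0)" by (rule continuous_on_subset) auto
  then obtain y0 where y0: "y0 \<in> {1..Y}" "\<And>y. y \<in> {1..Y} \<Longrightarrow> lattice_energy b 0 y0 \<le> lattice_energy b 0 y"
    using continuous_attains_inf[of "{1..Y}" "lattice_energy b 0"] Y(1) by auto
  have "lattice_energy b 0 y0 \<le> lattice_energy b 0 y" if "y \<ge> 1" for y
  proof (cases "y \<le> Y")
    case True
    thus ?thesis using y0(2) that by simp
  next
    case False
    thus ?thesis using y0(2)[of 1] Y(1) Y(2)[of y] by simp
  qed
  thus thesis using that[of y0] y0(1) by auto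
qed

lemma lattice_energy_minimum_above_1:
  assumes "b \<ge> 3"
  obtains y0 where "y0 \<ge> 1" "\<And>x y. y \<ge> 1 \<Longrightarrow> lattice_energy b 0 y0 \<le> lattice_energy b x y"
proof -
  have "b \<ge> 0" using assms by simp
  then obtain y0 where "y0 \<ge> 1" "\<And>y. y \<ge> 1 \<Longrightarrow> lattice_energy b 0 y0 \<le> lattice_energy b 0 y"
    using lattice_energy_attains_axis_minimum by blast
  thus thesis using that lattice_energy_ge_axis[OF _ assms] by (meson order_trans)
qed

lemma lattice_energy_lower_bound_half_plane:
  assumes "b \<ge> 3.062" and minimum: "\<And>x y. y \<ge> 1 \<Longrightarrow> c \<le> lattice_energy b x y"
    and "y > 0"
  shows "c \<le> lattice_energy b x y"
proof -
  obtain x' y' where reduced: "y' > 0" "lattice_equiv x y x' y'" "0 \<le> x'" "x' \<le> 1 / 2" "1 \<le> x'\<^sup>2 + y'\<^sup>2"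
    using lattice_reduction[OF assms(3)] by blast
  have "c \<le> lattice_energy b x' y'"
  proof (cases "y' \<ge> 1")
    case True
    thus ?thesis by (rule minimum)
  next
    case False
    have "x'\<^sup>2 \<le> (1 / 2)\<^sup>2" using reduced by (intro power_mono) auto
    hence "0.866\<^sup>2 \<le> y'\<^sup>2" using reduced(5) by (simp add: power_divide)
    hence "0.866 \<le> y'" using reduced(1) by (meson less_imp_le power2_le_imp_le)
    hence "lattice_energy b 0 1 \<le> lattice_energy b x' y'"
      using False reduced assms(1) by (intro lattice_energy_ge_square) auto
    thus ?thesis using minimum[of 1 0] by simp
  qed
  thus ?thesis
    using lattice_equiv_lattice_sum[OF reduced(2)] by (simp add: lattice_energy_def)
qed

lemma Gamma_a_subset_closure_D_G: "Gamma_a \<subseteq> closure D_G"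
proof
  fix z assume z: "z \<in> Gamma_a"
  define w where "w n = Complex (1 / real (n + 3)) (Im z)" for n :: nat
  have "w n \<in> D_G" for n
  proof -
    have "1 \<le> (Im z)\<^sup>2" using z by (intro one_le_power) (simp add: Gamma_a_def)
    moreover have "0 < (1 / real (n + 3))\<^sup>2" by simp
    ultimately have "1 < (1 / real (n + 3))\<^sup>2 + (Im z)\<^sup>2" by linarith
    hence "1 < cmod (w n)" by (simp add: w_def cmod_def)
    thus ?thesis using z by (auto simp: D_G_def w_def Gamma_a_def field_simps)
  qed
  moreover have "w \<longlonglongrightarrow> z"
  proof -
    have "(\<lambda>n. 1 / real (n + 3)) \<longlonglongrightarrow> 0"
      using LIMSEQ_ignore_initial_segment[OF lim_1_over_n, of 3] by simp
    hence "w \<longlonglongrightarrow> Complex 0 (Im z)" unfolding w_def[abs_def] by (intro tendsto_intros)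
    moreover have "Complex 0 (Im z) = z" using z by (simp add: Gamma_a_def complex_eq_iff)
    ultimately show ?thesis by simp
  qed
  ultimately show "z \<in> closure D_G" unfolding closure_sequential by blast
qed

lemma closure_D_G_subset_upper_half_plane: "closure D_G \<subseteq> upper_half_plane"
proof -
  let ?T = "{z. 0 \<le> Re z} \<inter> {z. Re z \<le> 1 / 2} \<inter> {z. 0 \<le> Im z} \<inter> {z. 1 \<le> cmod z}"
  have "closed ?T"
    by (intro closed_Int closed_Collect_le continuous_intros)
  hence "closure D_G \<subseteq> ?T" by (intro closure_minimal) (auto simp: D_G_def)
  moreover have "Im z > 0" if "z \<in> ?T" for z
  proof (rule ccontr)
    assume "\<not> Im z > 0"
    hence "Im z = 0" using that by simp
    hence "cmod z = \<bar>Re z\<bar>" by (simp add: cmod_def)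
    thus False using that by auto
  qed
  ultimately show ?thesis unfolding upper_half_plane_def by blast
qed

lemma is_min_onI:
  assumes "z \<in> S" "\<And>w. w \<in> S \<Longrightarrow> f z \<le> f w"
  shows "is_min_on f S (f z)"
  using assms by (auto simp: is_min_on_def)

theorem theorem3p2:
  shows "(\<forall>b::real. b \<ge> 3062 / 1000 \<longrightarrow>
            (\<exists>m. is_min_on (\<lambda>z. epstein_zeta 6 z - b * epstein_zeta 3 z) upper_half_plane m
               \<and> is_min_on (\<lambda>z. epstein_zeta 6 z - b * epstein_zeta 3 z) (closure D_G) m
               \<and> is_min_on (\<lambda>z. epstein_zeta 6 z - b * epstein_zeta 3 z) Gamma_path m))
       \<and> (\<forall>b::real. b \<ge> 3 \<longrightarrow>
            (\<exists>m. is_min_on (\<lambda>z. epstein_zeta 6 z - b * epstein_zeta 3 z)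
                     (closure D_G \<inter> {z. Im z \<ge> 1}) m
               \<and> is_min_on (\<lambda>z. epstein_zeta 6 z - b * epstein_zeta 3 z) Gamma_a m))"
proof (intro conjI allI impI)
  fix b :: real
  let ?W = "\<lambda>z. epstein_zeta 6 z - b * epstein_zeta 3 z"
  note subsets = closure_D_G_subset_upper_half_plane Gamma_a_subset_closure_D_G
  show "\<exists>m. is_min_on ?W (closure D_G \<inter> {z. Im z \<ge> 1}) m \<and> is_min_on ?W Gamma_a m" if b: "b \<ge> 3"
  proof -
    obtain y0 where "y0 \<ge> 1" "\<And>x y. y \<ge> 1 \<Longrightarrow> lattice_energy b 0 y0 \<le> lattice_energy b x y"
      using lattice_energy_minimum_above_1[OF b] by blast
    hence "Complex 0 y0 \<in> Gamma_a" "\<And>z. Im z \<ge> 1 \<Longrightarrow> ?W (Complex 0 y0) \<le> ?W z"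
      by (simp_all add: Gamma_a_def epstein_zeta_eq_lattice_energy)
    thus ?thesis
      using subsets by (intro exI[of _ "?W (Complex 0 y0)"] conjI is_min_onI) (auto simp: Gamma_a_def)
  qed
  show "\<exists>m. is_min_on ?W upper_half_plane m \<and> is_min_on ?W (closure D_G) m \<and> is_min_on ?W Gamma_path m"
    if b: "b \<ge> 3062 / 1000"
  proof -
    have "b \<ge> 3" "b \<ge> 3.062" using b by simp_all
    then obtain y0 where "y0 \<ge> 1" "\<And>x y. y > 0 \<Longrightarrow> lattice_energy b 0 y0 \<le> lattice_energy b x y"
      using lattice_energy_minimum_above_1 lattice_energy_lower_bound_half_plane by metis
    hence "Complex 0 y0 \<in> Gamma_a" "\<And>z. z \<in> upper_half_plane \<Longrightarrow> ?W (Complex 0 y0) \<le> ?W z"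
      by (simp_all add: Gamma_a_def upper_half_plane_def epstein_zeta_eq_lattice_energy)
    thus ?thesis
      using subsets by (intro exI[of _ "?W (Complex 0 y0)"] conjI is_min_onI)
        (auto simp: Gamma_path_def Gamma_a_def Gamma_b_def upper_half_plane_def)
  qed
qed

end
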